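(* Let $P$ be a multivariate Gaussian distribution with covariance matrix $\Sigma$ on a finite set of real random variables $\mathbf{V}$. Consider two conditional independencies $$(T_1)\ \ \mathbf{A}\perp\!\!\!\perp \mathbf{B}\mid \mathbf{C},\qquad (T_2)\ \ \mathbf{A}'\perp\!\!\!\perp \mathbf{B}'\mid \mathbf{C}',$$ where $\mathbf{A},\mathbf{B},\mathbf{C}$ and $\mathbf{A}',\mathbf{B}',\mathbf{C}'$ are sets of variables in $\mathbf{V}$ (the two triples may overlap). Then both the moment projection $P^{\perp\!\!\!\perp}:=\Pi_{T_2}(P)$ and $\mathrm{CIMD}(T_1,T_2,P)$ can be computed in closed form directly from $\Sigma$, as follows. (1) Moment projection. Let $\mathbf{X}'=\mathbf{V}\setminus(\mathbf{A}'\cup\mathbf{B}'\cup\mathbf{C}')$ be the remaining variables, and let $\Sigma^{\perp\!\!\!\perp}$ be the covariance of $P^{\perp\!\!\!\perp}$. Then $P^{\perp\!\!\!\perp}(\mathbf{C}')=P(\mathbf{C}')$, $P^{\perp\!\!\!\perp}(\mathbf{A}'\mid\mathbf{C}')=P(\mathbf{A}'\mid\mathbf{C}')$, $P^{\perp\!\!\!\perp}(\mathbf{B}'\mid\mathbf{C}')=P(\mathbf{B}'\mid\mathbf{C}')$ and $P^{\perp\!\!\!\perp}(\mathbf{X}'\mid\mathbf{A}',\mathbf{B}',\mathbf{C}')=P(\mathbf{X}'\mid\mathbf{A}',\mathbf{B}',\mathbf{C}')$, and hence $\Sigma^{\perp\!\!\!\perp}$ agrees with $\Sigma$ except in the two sub-matrices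 $\Sigma^{\perp\!\!\!\perp}_{\mathbf{A}'\cup\mathbf{B}',\,\mathbf{A}'\cup\mathbf{B}'}$ and $\Sigma^{\perp\!\!\!\perp}_{\mathbf{X}',\mathbf{X}'}$. The first is obtained by setting the conditional covariance given $\mathbf{C}'$ (the Schur complement of block $\mathbf{C}'$) to zero: $$\Sigma^{\perp\!\!\!\perp}_{\mathbf{A}'\cup\mathbf{B}',\,\mathbf{A}'\cup\mathbf{B}'}=\Sigma_{\mathbf{A}'\cup\mathbf{B}',\,\mathbf{C}'}\,(\Sigma_{\mathbf{C}',\mathbf{C}'})^{-1}\,\Sigma_{\mathbf{C}',\,\mathbf{A}'\cup\mathbf{B}'}.$$ The second propagates this change through $P(\mathbf{X}'\mid\mathbf{A}',\mathbf{B}',\mathbf{C}')$: with $\overline{\mathbf{X}'}:=\mathbf{A}'\cup\mathbf{B}'\cup\mathbf{C}'$ and $$\Sigma^{\perp\!\!\!\perp}_{\overline{\mathbf{X}'},\overline{\mathbf{X}'}}=\begin{bmatrix}\Sigma^{\perp\!\!\!\perp}_{\mathbf{A}'\cup\mathbf{B}',\,\mathbf{A}'\cup\mathbf{B}'} & \Sigma_{\mathbf{A}'\cup\mathbf{B}',\,\mathbf{C}'}\\ \Sigma_{\mathbf{C}',\,\mathbf{A}'\cup\mathbf{B}'} & \Sigma_{\mathbf{C}',\mathbf{C}'}\end{bmatrix},$$ one has, when the inverses exist, $$\Omega_{\overline{\mathbf{X}'},\overline{\mathbf{X}'}}:=(\Sigma^{\perp\!\!\!\perp}_{\overline{\mathbf{X}'},\overline{\mathbf{X}'}})^{-1}-\Sigma_{\overline{\mathbf{X}'},\overline{\mathbf{X}'}}^{-1},\qquad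 \Sigma^{\perp\!\!\!\perp}_{\mathbf{X}',\mathbf{X}'}=\Sigma_{\mathbf{X}',\mathbf{X}'}+\Sigma_{\mathbf{X}',\overline{\mathbf{X}'}}\,\Omega_{\overline{\mathbf{X}'},\overline{\mathbf{X}'}}\,\Sigma_{\overline{\mathbf{X}'},\mathbf{X}'}.$$ (2) CIMD. Let $\mathbf{Z}=\mathbf{A}\cup\mathbf{B}$, and let $\Phi$ and $\Phi^{\perp\!\!\!\perp}$ be the conditional covariances of $\mathbf{Z}$ given $\mathbf{C}$ under $P$ and under $P^{\perp\!\!\!\perp}$ respectively: $$\Phi=\Sigma_{\mathbf{Z},\mathbf{Z}}-\Sigma_{\mathbf{Z},\mathbf{C}}(\Sigma_{\mathbf{C},\mathbf{C}})^{-1}\Sigma_{\mathbf{C},\mathbf{Z}},\qquad \Phi^{\perp\!\!\!\perp}=\Sigma^{\perp\!\!\!\perp}_{\mathbf{Z},\mathbf{Z}}-\Sigma^{\perp\!\!\!\perp}_{\mathbf{Z},\mathbf{C}}(\Sigma^{\perp\!\!\!\perp}_{\mathbf{C},\mathbf{C}})^{-1}\Sigma^{\perp\!\!\!\perp}_{\mathbf{C},\mathbf{Z}}.$$ Then $$\mathrm{CIMD}(T_1,T_2,P)=\frac12\log\left(\frac{\det(\Phi_{\mathbf{A},\mathbf{A}})\det(\Phi_{\mathbf{B},\mathbf{B}})}{\det(\Phi)}\right)-\frac12\log\left(\frac{\det(\Phi^{\perp\!\!\!\perp}_{\mathbf{A},\mathbf{A}})\det(\Phi^{\perp\!\!\!\perp}_{\mathbf{B},\mathbf{B}})}{\det(\Phi^{\perp\!\!\!\perp})}\right),$$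 where $\Phi_{\mathbf{A},\mathbf{A}}$ and $\Phi_{\mathbf{B},\mathbf{B}}$ reduce to scalars when $\mathbf{A}$ and $\mathbf{B}$ are single variables. Both terms depend on $P$ only through $\Sigma$, so CIMD is a function of the covariance matrix alone.
   Context: For a matrix $M$ indexed by variables, $M_{\mathbf{S},\mathbf{T}}$ denotes the sub-matrix with rows $\mathbf{S}$ and columns $\mathbf{T}$. KL divergence: for distributions $P,Q$ with densities $p,q$, $D(P\|Q)=\mathbb{E}_{x\sim P}[\log(p(x)/q(x))]$. Moment projection: for a conditional independence $T$, let $\mathcal{P}_T$ be the set of distributions satisfying $T$. The moment projection of $P$ onto $T$ is $\Pi_T(P)=\arg\min_{Q\in\mathcal{P}_T}D(P\|Q)$. Conditional mutual information: $I_P(\mathbf{A}:\mathbf{B}\mid\mathbf{C})=\mathbb{E}_P\left[\log\frac{p(\mathbf{a},\mathbf{b}\mid\mathbf{c})}{p(\mathbf{a}\mid\mathbf{c})\,p(\mathbf{b}\mid\mathbf{c})}\right]$; $I_Q$ denotes the same functional under the distribution $Q$. CI Meta-Dependence: for $T_1:\ \mathbf{A}\perp\!\!\!\perp\mathbf{B}\mid\mathbf{C}$ and $T_2:\ \mathbf{A}'\perp\!\!\!\perp\mathbf{B}'\mid\mathbf{C}'$, $$\mathrm{CIMD}(T_1,T_2,P)=I_P(\mathbf{A}:\mathbf{B}\mid\mathbf{C})-I_{\Pi_{T_2}(P)}(\mathbf{A}:\mathbf{B}\mid\mathbf{C}).$$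
   Formalization: Three printed formulas fail. Proved instead: the first formula only on A'×B' and B'×A' (A'×A', B'×B' unchanged); the X'×(A'∪B') block also changes; and Σ⊥_{X',X'} = Σ_{X',X'} − Σ⊥_{X',Y}ΩΣ_{Y,X'} with Y=A'∪B'∪C'. P is nondegenerate; each triple is disjoint. *)

theory Defs
  imports "HOL-Probability.Probability"
begin

text \<open>
  The set of variables is a finite type \<open>'v\<close>; a joint outcome is a function \<open>'v \<Rightarrow> real\<close>, and
  the outcomes of a subset of the variables are the extensional functions on that subset.
\<close>

section \<open>Sub-matrices\<close>

text \<open>
  A sub-matrix with rows \<open>S\<close> and columns \<open>T\<close> is kept in the ambient index type, with zero entries
  outside \<open>S \<times> T\<close>, so that the usual matrix operations act on it as on the block.  For inverses and
  determinants the principal block is completed by the identity on the remaining indices; the two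
  lemmas below confirm that this gives the inverse and the determinant of the block.
\<close>

definition sub :: "'v set \<Rightarrow> 'v set \<Rightarrow> real^'v^'v \<Rightarrow> real^'v::finite^'v" where
  "sub S T M = (\<chi> i j. if i \<in> S \<and> j \<in> T then M $ i $ j else 0)"

definition completed_block :: "'v set \<Rightarrow> real^'v^'v \<Rightarrow> real^'v::finite^'v" where
  "completed_block S M = (\<chi> i j. if i \<in> S \<and> j \<in> S then M $ i $ j else if i = j then 1 else 0)"

definition sub_det :: "'v set \<Rightarrow> real^'v^'v::finite \<Rightarrow> real" where
  "sub_det S M = det (completed_block S M)"

definition sub_inv :: "'v set \<Rightarrow> real^'v^'v \<Rightarrow> real^'v::finite^'v" where
  "sub_inv S M = sub S S (matrix_inv (completed_block S M))"

lemma sub_det_Leibniz: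
  fixes M :: "real^'v::finite^'v"
  shows "sub_det S M = (\<Sum>p | p permutes S. of_int (sign p) * (\<Prod>i\<in>S. M $ i $ p i))"
proof -
  let ?N = "completed_block S M"
  have "sub_det S M = (\<Sum>p | p permutes UNIV. of_int (sign p) * (\<Prod>i\<in>UNIV. ?N $ i $ p i))"
    by (simp add: sub_det_def det_def)
  also have "\<dots> = (\<Sum>p | p permutes S. of_int (sign p) * (\<Prod>i\<in>UNIV. ?N $ i $ p i))"
  proof (rule sum.mono_neutral_right)
    show "finite {p. p permutes (UNIV :: 'v set)}"
      by (rule finite_permutations) simp
    show "{p. p permutes S} \<subseteq> {p. p permutes UNIV}"
      using permutes_subset by blast
    show "\<forall>p\<in>{p. p permutes UNIV} - {p. p permutes S}.
            of_int (sign p) * (\<Prod>i\<in>UNIV. ?N $ i $ p i) = 0"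
    proof
      fix p assume p: "p \<in> {p. p permutes UNIV} - {p. p permutes S}"
      then obtain i where i: "i \<notin> S" "p i \<noteq> i"
        unfolding permutes_def by auto
      then have "?N $ i $ p i = 0"
        by (auto simp: completed_block_def)
      then have "(\<Prod>i\<in>UNIV. ?N $ i $ p i) = 0"
        by (intro prod_zero) auto
      then show "of_int (sign p) * (\<Prod>i\<in>UNIV. ?N $ i $ p i) = 0"
        by simp
    qed
  qed
  also have "\<dots> = (\<Sum>p | p permutes S. of_int (sign p) * (\<Prod>i\<in>S. M $ i $ p i))"
  proof (rule sum.cong[OF refl])
    fix p assume "p \<in> {p. p permutes S}"
    then have p: "p permutes S" by simp
    have "(\<Prod>i\<in>UNIV. ?N $ i $ p i) = (\<Prod>i\<in>S. ?N $ i $ p i)"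
      by (rule prod.mono_neutral_right)
        (auto simp: completed_block_def permutes_not_in[OF p])
    also have "\<dots> = (\<Prod>i\<in>S. M $ i $ p i)"
      by (rule prod.cong) (auto simp: completed_block_def permutes_in_image[OF p])
    finally show "of_int (sign p) * (\<Prod>i\<in>UNIV. ?N $ i $ p i)
        = of_int (sign p) * (\<Prod>i\<in>S. M $ i $ p i)" by simp
  qed
  finally show ?thesis .
qed

lemma sub_inv_right:
  fixes M :: "real^'v::finite^'v"
  assumes "sub_det S M \<noteq> 0"
  shows "sub S S M ** sub_inv S M = sub S S (mat 1)"
proof -
  let ?N = "completed_block S M" and ?K = "matrix_inv (completed_block S M)"
  have "invertible ?N"
    using assms by (simp add: sub_det_def invertible_det_nz)
  then have NK: "?N ** ?K = mat 1"
    unfolding matrix_inv_def invertible_def by (rule someI2_ex) auto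
  have "(sub S S M ** sub_inv S M) $ i $ j = sub S S (mat 1) $ i $ j" for i j
  proof (cases "i \<in> S \<and> j \<in> S")
    case True
    have "(sub S S M ** sub_inv S M) $ i $ j = (\<Sum>k\<in>UNIV. ?N $ i $ k * ?K $ k $ j)"
      unfolding matrix_matrix_mult_def vec_lambda_beta
      by (rule sum.cong) (use True in \<open>auto simp: sub_def sub_inv_def completed_block_def\<close>)
    also have "\<dots> = (?N ** ?K) $ i $ j"
      by (simp add: matrix_matrix_mult_def)
    finally show ?thesis
      using True by (simp add: NK sub_def)
  next
    case False
    then show ?thesis
      by (auto simp: matrix_matrix_mult_def sub_def sub_inv_def intro!: sum.neutral)
  qed
  then show ?thesis by (simp add: vec_eq_iff)
qed

section \<open>Distributions, densities and conditional densities\<close>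

abbreviation leb :: "'v set \<Rightarrow> ('v \<Rightarrow> real) measure" where
  "leb S \<equiv> \<Pi>\<^sub>M i\<in>S. lborel"

definition distributions :: "('v::finite \<Rightarrow> real) measure set" where
  "distributions =
    {Q. prob_space Q \<and> (\<exists>q \<in> borel_measurable (leb UNIV). Q = density (leb UNIV) q)}"

definition marginal :: "('v::finite \<Rightarrow> real) measure \<Rightarrow> 'v set \<Rightarrow> ('v \<Rightarrow> real) measure" where
  "marginal Q S = distr Q (leb S) (\<lambda>x. restrict x S)"

text \<open>
  \<open>mdens Q S x\<close> is \<open>q(s)\<close> and \<open>cdens Q S T x\<close> is \<open>q(s | t)\<close>, where \<open>s\<close> and \<open>t\<close> are the values
  of the variables \<open>S\<close> and \<open>T\<close> in the joint outcome \<open>x\<close>.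
\<close>

definition mdens :: "('v::finite \<Rightarrow> real) measure \<Rightarrow> 'v set \<Rightarrow> ('v \<Rightarrow> real) \<Rightarrow> real" where
  "mdens Q S x = enn2real (RN_deriv (leb S) (marginal Q S) (restrict x S))"

definition cdens ::
  "('v::finite \<Rightarrow> real) measure \<Rightarrow> 'v set \<Rightarrow> 'v set \<Rightarrow> ('v \<Rightarrow> real) \<Rightarrow> real" where
  "cdens Q S T x = mdens Q (S \<union> T) x / mdens Q T x"

definition covariance_matrix :: "('v::finite \<Rightarrow> real) measure \<Rightarrow> real^'v^'v" where
  "covariance_matrix Q = (\<chi> i j.
    \<integral>x. (x i - (\<integral>y. y i \<partial>Q)) * (x j - (\<integral>y. y j \<partial>Q)) \<partial>Q)"

definition positive_definite :: "real^'v::finite^'v \<Rightarrow> bool" where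
  "positive_definite M \<longleftrightarrow> transpose M = M \<and> (\<forall>x. x \<noteq> 0 \<longrightarrow> 0 < x \<bullet> (M *v x))"

definition gaussian :: "real^'v \<Rightarrow> real^'v^'v \<Rightarrow> ('v::finite \<Rightarrow> real) measure" where
  "gaussian \<mu> \<Sigma> = density (leb UNIV) (\<lambda>x. ennreal
    (exp (- (1/2) * (((\<chi> i. x i) - \<mu>) \<bullet> (matrix_inv \<Sigma> *v ((\<chi> i. x i) - \<mu>))))
      / sqrt ((2 * pi) ^ CARD('v) * det \<Sigma>)))"

section \<open>Conditional independence, moment projection and CIMD\<close>

text \<open>The triple \<open>(A, B, C)\<close> stands for the conditional independence of \<open>A\<close> and \<open>B\<close> given \<open>C\<close>.\<close>

type_synonym 'v ci = "'v set \<times> 'v set \<times> 'v set"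

fun satisfies_ci :: "('v::finite \<Rightarrow> real) measure \<Rightarrow> 'v ci \<Rightarrow> bool" where
  "satisfies_ci Q (A, B, C) \<longleftrightarrow>
    (AE x in leb UNIV. cdens Q (A \<union> B) C x = cdens Q A C x * cdens Q B C x)"

text \<open>
  \<open>KL_divergence b N M\<close> of the library is the divergence of \<open>M\<close> from \<open>N\<close>, so the arguments are
  swapped.  The negative part of the log-ratio is always integrable with respect to \<open>P\<close>; hence a
  log-ratio that is not integrable has expectation \<open>\<infinity>\<close>.
\<close>

definition KL :: "'a measure \<Rightarrow> 'a measure \<Rightarrow> ereal" where
  "KL P Q = (if absolutely_continuous Q P \<and> integrable P (entropy_density (exp 1) Q P)
             then ereal (KL_divergence (exp 1) Q P) else \<infinity>)"

definition moment_projection ::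
  "'v ci \<Rightarrow> ('v::finite \<Rightarrow> real) measure \<Rightarrow> ('v \<Rightarrow> real) measure" where
  "moment_projection T P = (ARG_MIN (KL P) Q. Q \<in> distributions \<and> satisfies_ci Q T)"

fun cond_mutual_info :: "('v::finite \<Rightarrow> real) measure \<Rightarrow> 'v ci \<Rightarrow> real" where
  "cond_mutual_info Q (A, B, C) =
    (\<integral>x. ln (cdens Q (A \<union> B) C x / (cdens Q A C x * cdens Q B C x)) \<partial>Q)"

definition CIMD :: "'v ci \<Rightarrow> 'v ci \<Rightarrow> ('v::finite \<Rightarrow> real) measure \<Rightarrow> real" where
  "CIMD T1 T2 P = cond_mutual_info P T1 - cond_mutual_info (moment_projection T2 P) T1"

text \<open>The Schur complement of the block \<open>C\<close>, on the variables \<open>Z\<close>.\<close>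

definition cond_cov :: "'v set \<Rightarrow> 'v set \<Rightarrow> real^'v^'v \<Rightarrow> real^'v::finite^'v" where
  "cond_cov Z C M = sub Z Z M - sub Z C M ** sub_inv C M ** sub C Z M"

end

theory Submission
  imports Defs
begin

text \<open>
  Under \<open>P\<close> let \<open>g S\<close> be the marginal density on \<open>S\<close>, and let \<open>Y = A \<union> B \<union> C\<close> for the triple of the
  projection.  The density \<open>g (A \<union> C) * g (B \<union> C) / g C * g UNIV / g Y\<close> satisfies the independence.
  The ratio of any competitor \<open>q\<close> to it is the product of three ratios of conditional densities of
  \<open>q\<close> and of \<open>P\<close>, each of expectation 1 under \<open>P\<close>.  Since \<open>ln r \<le> r - 1\<close>, with equality only at 1,
  it is the unique minimizer.  The corresponding sum \<open>K (A \<union> C) + K (B \<union> C) - K C + K UNIV - K Y\<close> of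
  precision matrices \<open>K S\<close> of the blocks is positive definite, and its inverse is the covariance
  matrix of the theorem.  The information formula is the entropy of a Gaussian together with the
  determinant formula for Schur complements.
\<close>

section \<open>Block matrix algebra\<close>

text \<open>Every block lives in the one type of square matrices. The projections
  \<open>coord S\<close> cut blocks out, so block algebra becomes rewriting in a noncommutative
  ring, driven by \<open>coord S ** (\<Sigma> ** sub_inv T \<Sigma>) = coord S\<close> for
  \<open>S \<subseteq> T\<close>. The three ratios come from the chain rule: with X the remaining
  variables, any \<open>q\<close> satisfying the independence factors as q(A,C) q(B|C) q(X|Y), and
  the candidate has the same factors taken from \<open>P\<close>. The obstacle is that a competitor
  is arbitrary: its density may vanish, and the logarithms of the single ratios need not be
  integrable. If its divergence is at most the finite one of the candidate, then \<open>P\<close> is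
  absolutely continuous with respect to it and its density is positive almost everywhere. The
  logarithm of the whole product is then integrable, as a difference of two integrable log-ratios,
  and the three estimates are added before integrating. Gaussian marginals and covariances are found
  by adjoining one variable at a time, which is a rank-one update of the block precision.\<close>

definition coord :: "'v set \<Rightarrow> real^'v::finite^'v" where
  "coord S = (\<chi> i j. if i = j \<and> i \<in> S then 1 else 0)"

lemma matrix_diff_ldistrib: "A ** (B - C) = A ** B - A ** (C :: real^'n^'m::finite)"
  by (vector matrix_matrix_mult_def sum_subtractf right_diff_distrib)

lemma matrix_diff_rdistrib: "(B - C) ** A = B ** A - C ** (A :: real^'n^'m::finite)"
  by (vector matrix_matrix_mult_def sum_subtractf left_diff_distrib)

lemma matrix_add_rdistrib: "(B + C) ** A = B ** A + C ** (A :: real^'n^'m::finite)"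
  by (vector matrix_matrix_mult_def sum.distrib distrib_right)

lemma matrix_mult_zero: "A ** 0 = (0 :: real^'n^'m)" "0 ** B = (0 :: real^'n^'m)"
  by (vector matrix_matrix_mult_def)+

lemma matrix_mult_minus: "A ** (- B) = - (A ** (B :: real^'n^'m::finite))"
    "(- C) ** D = - (C ** (D :: real^'n^'m::finite))"
  by (vector matrix_matrix_mult_def sum_negf)+

lemma transpose_diff: "transpose (A - B) = transpose A - transpose (B :: real^'n^'m)"
  and transpose_add: "transpose (A + B) = transpose A + transpose (B :: real^'n^'m)"
  by (vector transpose_def)+

lemmas matrix_ring = matrix_mul_assoc[symmetric] matrix_add_ldistrib matrix_add_rdistrib
  matrix_diff_ldistrib matrix_diff_rdistrib matrix_mult_zero

lemma coord_mult_nth: "(coord S ** M) $ i $ j = (if i \<in> S then M $ i $ j else 0)"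
proof -
  have "(coord S ** M) $ i $ j = (\<Sum>k\<in>UNIV. if i = k then (if i \<in> S then M $ i $ j else 0) else 0)"
    unfolding matrix_matrix_mult_def coord_def vec_lambda_beta by (intro sum.cong) auto
  then show ?thesis by simp
qed

lemma mult_coord_nth: "(M ** coord S) $ i $ j = (if j \<in> S then M $ i $ j else 0)"
proof -
  have "(M ** coord S) $ i $ j = (\<Sum>k\<in>UNIV. if j = k then (if j \<in> S then M $ i $ j else 0) else 0)"
    unfolding matrix_matrix_mult_def coord_def vec_lambda_beta by (intro sum.cong) auto
  then show ?thesis by simp
qed

lemma coord_mult_vec_nth: "(coord S *v x) $ i = (if i \<in> S then x $ i else 0)"
proof -
  have "(coord S *v x) $ i = (\<Sum>k\<in>UNIV. if i = k then (if i \<in> S then x $ i else 0) else 0)"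
    unfolding matrix_vector_mult_def coord_def vec_lambda_beta by (intro sum.cong) auto
  then show ?thesis by simp
qed

lemma sub_eq: "sub S T M = coord S ** M ** coord T"
  by (vector sub_def coord_mult_nth mult_coord_nth)

lemma coord_mult: "coord S ** coord T = coord (S \<inter> T)"
  by (simp add: vec_eq_iff coord_mult_nth) (auto simp: coord_def)

lemma coord_mult': "coord S ** (coord T ** M) = coord (S \<inter> T) ** M"
  by (simp add: matrix_mul_assoc coord_mult)

lemma coord_UNIV [simp]: "coord UNIV = mat 1"
  and coord_empty [simp]: "coord {} = 0"
  by (auto simp: coord_def mat_def vec_eq_iff)

lemma coord_Un: "S \<inter> T = {} \<Longrightarrow> coord (S \<union> T) = coord S + coord T"
  by (auto simp: coord_def vec_eq_iff)

lemma coord_Compl: "coord (- S) = mat 1 - coord S"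
  by (auto simp: coord_def vec_eq_iff mat_def)

lemma transpose_coord [simp]: "transpose (coord S) = coord S"
  by (auto simp: coord_def vec_eq_iff transpose_def)

lemma completed_block_eq: "completed_block S M = coord S ** M ** coord S + coord (- S)"
  by (auto simp: vec_eq_iff completed_block_def coord_mult_nth mult_coord_nth) (auto simp:
      coord_def)

lemma sub_inv_UNIV: "sub_inv UNIV M = matrix_inv M"
  and sub_det_UNIV: "sub_det UNIV M = det M"
  by (simp_all add: sub_inv_def sub_det_def completed_block_eq sub_eq)

lemma sub_inv_cong: "sub S S M = sub S S N \<Longrightarrow> sub_inv S M = sub_inv S N"
  and sub_det_cong: "sub S S M = sub S S N \<Longrightarrow> sub_det S M = sub_det S N"
  by (simp_all add: sub_inv_def sub_det_def completed_block_eq flip: sub_eq)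

lemma sub_det_empty [simp]: "sub_det {} M = 1"
  by (simp add: sub_det_def completed_block_eq matrix_ring)

text \<open>
  With \<open>S\<close> and \<open>T\<close> disjoint, the sign change on \<open>T\<close> conjugates \<open>mat 1 + R\<close> into its inverse
  \<open>mat 1 - R\<close>, so the determinant is \<open>\<plusminus>1\<close>; and \<open>mat 1 + R\<close> is the square of \<open>mat 1 + R/2\<close>.
\<close>

lemma det_unitriangular:
  fixes N :: "real^'v::finite^'v"
  assumes "S \<inter> T = {}"
  shows "det (mat 1 + coord T ** N ** coord S) = 1"
proof -
  define f where "f N = mat 1 + coord T ** N ** coord S" for N :: "real^'v^'v"
  have ff: "f M ** f N = f (M + N)" for M N
    using assms by (simp add: f_def matrix_ring coord_mult coord_mult' algebra_simps)
  have f0: "f 0 = mat 1"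
    by (simp add: f_def matrix_ring)
  define E :: "real^'v^'v" where "E = coord (- T) - coord T"
  have EE: "E ** E = mat 1"
    by (simp add: E_def matrix_ring coord_mult) (simp add: coord_Compl)
  have "S \<inter> T = {}" "S \<inter> - T = S"
    using assms by auto
  then have R: "coord S ** E = coord S" and L: "E ** coord T = - coord T"
    by (simp_all add: E_def matrix_ring coord_mult)
  have "E ** f N ** E = E ** E + (E ** coord T) ** (N ** (coord S ** E))" for N
    by (simp add: f_def matrix_ring)
  then have "E ** f N ** E = f (- N)" for N
    unfolding EE R L by (simp add: f_def matrix_mult_minus matrix_ring)
  then have "det (f (- N)) = (det E * det E) * det (f N)" for N
    by (metis det_mul mult.commute mult.left_commute)
  moreover have "det E * det E = 1"
    by (metis EE det_I det_mul)
  ultimately have neg: "det (f (- N)) = det (f N)" for N by simp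
  have "det (f N) * det (f N) = 1" for N
    by (metis add.right_inverse det_I det_mul f0 ff neg)
  then have "det (f ((1/2) *\<^sub>R N + (1/2) *\<^sub>R N)) = 1"
    by (metis det_mul ff)
  then show ?thesis
    by (simp add: f_def flip: scaleR_left_distrib)
qed

section \<open>Positive definite matrices\<close>

lemma positive_definite_transpose: "positive_definite M \<Longrightarrow> transpose M = M"
  by (simp add: positive_definite_def)

lemma inner_matrix_transpose: "x \<bullet> (M *v y) = (transpose M *v x) \<bullet> (y :: real^'n::finite)"
  by (simp add: dot_lmul_matrix)

lemma positive_definite_invertible:
  assumes "positive_definite M" shows "invertible M"
proof -
  have "x = 0" if "M *v x = 0" for x
    using assms that by (metis inner_zero_right less_irrefl positive_definite_def)
  then show ?thesis
    by (metis invertible_def matrix_left_invertible_ker matrix_left_right_inverse)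
qed

text \<open>Splitting a vector into its parts on and off \<open>S\<close> splits the form into that
  of \<open>M\<close> and a squared norm; a nonzero vector has a nonzero part.\<close>

lemma positive_definite_completed_block:
  assumes "positive_definite M" shows "positive_definite (completed_block S M)"
  unfolding positive_definite_def
proof (intro conjI allI impI)
  show "transpose (completed_block S M) = completed_block S M"
    using positive_definite_transpose[OF assms]
    by (simp add: completed_block_eq transpose_add matrix_transpose_mul matrix_ring)
  fix x :: "real^'a" assume "x \<noteq> 0"
  let ?y = "coord S *v x" and ?z = "coord (- S) *v x"
  have *: "x \<bullet> (completed_block S M *v x) = ?y \<bullet> (M *v ?y) + ?z \<bullet> ?z"
  proof -
    have "completed_block S M *v x = coord S *v (M *v ?y) + coord (- S) *v (coord (- S) *v x)"
      by (simp add: completed_block_eq matrix_vector_mult_add_rdistrib matrix_vector_mul_assoc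
          coord_mult matrix_mul_assoc)
    then have "x \<bullet> (completed_block S M *v x)
        = x \<bullet> (coord S *v (M *v ?y)) + x \<bullet> (coord (- S) *v (coord (- S) *v x))"
      by (simp add: inner_add_right)
    then show ?thesis
      by (simp only: inner_matrix_transpose[of x "coord _"] transpose_coord)
  qed
  have "?y \<noteq> 0 \<or> ?z \<noteq> 0"
    using \<open>x \<noteq> 0\<close> by (auto simp: vec_eq_iff coord_mult_vec_nth)
  then show "0 < x \<bullet> (completed_block S M *v x)"
    unfolding * using assms
    by (smt (verit) inner_gt_zero_iff inner_ge_zero inner_zero_left positive_definite_def)
qed

section \<open>Inverses and determinants of principal blocks\<close>

context
  fixes \<Sigma> :: "real^'v::finite^'v"
  assumes pd: "positive_definite \<Sigma>"
begin

lemma sub_det_nonzero: "sub_det S \<Sigma> \<noteq> 0"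
  using positive_definite_invertible[OF positive_definite_completed_block[OF pd]]
  by (simp add: sub_det_def invertible_det_nz)

lemma coord_sub_inv: "coord S ** sub_inv S \<Sigma> = sub_inv S \<Sigma>" "sub_inv S \<Sigma> ** coord S = sub_inv S \<Sigma>"
  by (simp_all add: sub_inv_def sub_eq matrix_ring coord_mult coord_mult')

lemma coord_sub_inv_subset:
  assumes "S \<subseteq> T" shows "coord T ** sub_inv S \<Sigma> = sub_inv S \<Sigma>" "sub_inv S \<Sigma> ** coord T = sub_inv S
      \<Sigma>"
proof -
  have *: "T \<inter> S = S" "S \<inter> T = S" using assms by auto
  show "coord T ** sub_inv S \<Sigma> = sub_inv S \<Sigma>"
    by (metis coord_sub_inv(1) coord_mult' *)
  show "sub_inv S \<Sigma> ** coord T = sub_inv S \<Sigma>"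
    by (metis coord_sub_inv(2) coord_mult matrix_mul_assoc *)
qed

lemma coord_sub_inv_disjoint:
  assumes "S \<inter> T = {}" shows "coord T ** sub_inv S \<Sigma> = 0" "sub_inv S \<Sigma> ** coord T = 0"
proof -
  have *: "T \<inter> S = {}" using assms by auto
  show "coord T ** sub_inv S \<Sigma> = 0"
    by (metis coord_sub_inv(1) coord_mult' * coord_empty matrix_mult_zero(2))
  show "sub_inv S \<Sigma> ** coord T = 0"
    by (metis coord_sub_inv(2) coord_mult matrix_mul_assoc assms coord_empty matrix_mult_zero(1))
qed

lemma coord_cov_sub_inv_same: "coord S ** (\<Sigma> ** sub_inv S \<Sigma>) = coord S"
proof -
  have "coord S ** \<Sigma> ** coord S ** sub_inv S \<Sigma> = coord S"
    using sub_inv_right[OF sub_det_nonzero, of S] by (simp add: sub_eq matrix_ring coord_mult)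
  then show ?thesis by (simp add: matrix_ring coord_sub_inv)
qed

text \<open>The block inverse K equals transpose K times \<Sigma> times K, which is visibly
  symmetric.\<close>

lemma transpose_sub_inv: "transpose (sub_inv S \<Sigma>) = sub_inv S \<Sigma>"
proof -
  have "transpose (sub_inv S \<Sigma>) ** (\<Sigma> ** coord S) = coord S"
    using arg_cong[OF coord_cov_sub_inv_same, of transpose S] positive_definite_transpose[OF pd]
    by (simp add: matrix_transpose_mul matrix_ring)
  then have "sub_inv S \<Sigma> = transpose (sub_inv S \<Sigma>) ** (\<Sigma> ** coord S) ** sub_inv S \<Sigma>"
    by (simp add: coord_sub_inv)
  then have *: "sub_inv S \<Sigma> = transpose (sub_inv S \<Sigma>) ** (\<Sigma> ** sub_inv S \<Sigma>)"
    by (simp add: matrix_ring coord_sub_inv)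
  show ?thesis
    by (subst (1 2) *)
       (simp add: matrix_transpose_mul positive_definite_transpose[OF pd] matrix_ring)
qed

lemma sub_inv_cov_coord_same: "sub_inv S \<Sigma> ** (\<Sigma> ** coord S) = coord S"
  using arg_cong[OF coord_cov_sub_inv_same, of transpose S] positive_definite_transpose[OF pd]
  by (simp add: matrix_transpose_mul transpose_sub_inv matrix_ring)

lemma coord_cov_sub_inv:
  assumes "S \<subseteq> T" shows "coord S ** (\<Sigma> ** sub_inv T \<Sigma>) = coord S"
proof -
  have "S \<inter> T = S" using assms by auto
  then show ?thesis by (metis coord_cov_sub_inv_same coord_mult coord_mult')
qed

lemma sub_inv_cov_coord:
  assumes "S \<subseteq> T" shows "sub_inv T \<Sigma> ** (\<Sigma> ** coord S) = coord S"
  using arg_cong[OF coord_cov_sub_inv[OF assms], of transpose] positive_definite_transpose[OF pd]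
  by (simp add: matrix_transpose_mul transpose_sub_inv matrix_ring)

text \<open>With \<Sigma> as the middle factor, block inverses of nested sets compose like nested
  orthogonal projections.\<close>

lemma sub_inv_cov_sub_inv:
  assumes "S \<subseteq> T" shows "sub_inv S \<Sigma> ** (\<Sigma> ** sub_inv T \<Sigma>) = sub_inv S \<Sigma>" "sub_inv T \<Sigma> ** (\<Sigma> **
      sub_inv S \<Sigma>) = sub_inv S \<Sigma>"
proof -
  have "sub_inv S \<Sigma> ** (\<Sigma> ** sub_inv T \<Sigma>) = sub_inv S \<Sigma> ** (coord S ** (\<Sigma> ** sub_inv T \<Sigma>))"
    by (metis coord_sub_inv(2) matrix_mul_assoc)
  then show "sub_inv S \<Sigma> ** (\<Sigma> ** sub_inv T \<Sigma>) = sub_inv S \<Sigma>"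
    by (simp add: coord_cov_sub_inv[OF assms] coord_sub_inv)
  have "sub_inv T \<Sigma> ** (\<Sigma> ** sub_inv S \<Sigma>) = sub_inv T \<Sigma> ** (\<Sigma> ** coord S) ** sub_inv S \<Sigma>"
    by (simp add: matrix_ring coord_sub_inv)
  then show "sub_inv T \<Sigma> ** (\<Sigma> ** sub_inv S \<Sigma>) = sub_inv S \<Sigma>"
    by (simp add: sub_inv_cov_coord[OF assms] coord_sub_inv)
qed

text \<open>The argument that a left inverse equals a right inverse, carried out inside the block.
  It later verifies guessed block inverses of the projected covariance.\<close>

lemma sub_inv_unique:
  assumes "coord S ** (\<Sigma> ** L) = coord S" "coord S ** L = L"
  shows "L = sub_inv S \<Sigma>"
proof -
  have "L = (sub_inv S \<Sigma> ** (\<Sigma> ** coord S)) ** L"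
    using assms(2) by (simp add: sub_inv_cov_coord_same)
  also have "\<dots> = sub_inv S \<Sigma> ** (coord S ** (\<Sigma> ** L))"
    using assms(2) by (simp add: matrix_mul_assoc coord_sub_inv) (simp add: assms(2) flip:
        matrix_mul_assoc)
  finally show ?thesis by (simp add: assms(1) coord_sub_inv)
qed

lemma cond_cov_eq: "cond_cov T S \<Sigma> = coord T ** (\<Sigma> - \<Sigma> ** sub_inv S \<Sigma> ** \<Sigma>) ** coord T"
  by (simp add: cond_cov_def sub_eq matrix_ring)
     (simp add: coord_sub_inv matrix_mul_assoc)

text \<open>Block elimination: the completed block on \<open>S \<union> T\<close> is a
  block-diagonal matrix between two unitriangular factors of determinant 1.\<close>

lemma sub_det_Un:
  assumes "S \<inter> T = {}"
  shows "sub_det (S \<union> T) \<Sigma> = sub_det S \<Sigma> * sub_det T (cond_cov T S \<Sigma>)"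
proof -
  define U where "U = - (S \<union> T)"
  have d: "T \<inter> S = {}" "S \<inter> T = {}" "- S \<inter> - T = U" "S \<inter> - T = S" "- S \<inter> T = T" "T \<inter> - S = T"
    "S \<inter> U = {}" "T \<inter> U = {}" "U \<inter> S = {}" "U \<inter> T = {}"
    using assms by (auto simp: U_def)
  have K0: "sub_inv S \<Sigma> ** coord U = 0" "sub_inv S \<Sigma> ** coord T = 0" "sub_inv S \<Sigma> ** (coord T ** X)
      = 0"
      "coord U ** sub_inv S \<Sigma> = 0" "coord U ** (sub_inv S \<Sigma> ** X) = 0"
      "coord T ** (sub_inv S \<Sigma> ** X) = 0" for X
    using coord_sub_inv_disjoint[OF d(7)] coord_sub_inv_disjoint[OF d(2)]
    by (simp_all add: matrix_mul_assoc matrix_mult_zero)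
  have K1: "coord S ** (sub_inv S \<Sigma> ** X) = sub_inv S \<Sigma> ** X" "sub_inv S \<Sigma> ** (coord S ** X) =
      sub_inv S \<Sigma> ** X"
      "sub_inv S \<Sigma> ** (\<Sigma> ** coord S) = coord S" "sub_inv S \<Sigma> ** (\<Sigma> ** (coord S ** X)) = coord S **
          X"
      "sub_inv S \<Sigma> ** (\<Sigma> ** (sub_inv S \<Sigma> ** X)) = sub_inv S \<Sigma> ** X" "coord S ** (\<Sigma> ** (sub_inv S \<Sigma>
          ** X)) = coord S ** X" for X
    using coord_cov_sub_inv_same[of S] coord_sub_inv sub_inv_cov_coord_same[of S]
        sub_inv_cov_sub_inv[of S S]
    by (simp_all add: matrix_mul_assoc)
  let ?L = "mat 1 + coord T ** (\<Sigma> ** sub_inv S \<Sigma>) ** coord S"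
  let ?R = "mat 1 + coord S ** (sub_inv S \<Sigma> ** \<Sigma>) ** coord T"
  define B where "B = coord T ** (\<Sigma> - \<Sigma> ** sub_inv S \<Sigma> ** \<Sigma>) ** coord T"
  define X where "X = coord S ** \<Sigma> ** coord S + B + coord U"
  \<comment> \<open>The two completed blocks act on disjoint index sets and are the identity
    elsewhere, so their product is block diagonal: \<Sigma> on \<open>S\<close>, the Schur
    complement on \<open>T\<close>, the identity on \<open>U\<close>.\<close>
  have X: "completed_block S \<Sigma> ** completed_block T (cond_cov T S \<Sigma>) = X"
    by (simp add: completed_block_eq cond_cov_eq matrix_ring coord_mult coord_mult' d X_def B_def)
  have "?L ** X = X + coord T ** (\<Sigma> ** coord S)"
    by (simp add: X_def B_def matrix_ring coord_mult coord_mult' d K0 K1 coord_sub_inv)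
  then have "?L ** X ** ?R
      = X + coord T ** (\<Sigma> ** coord S) + (X + coord T ** (\<Sigma> ** coord S)) ** (sub_inv S \<Sigma> ** (\<Sigma> **
          coord T))"
    by (simp add: matrix_add_ldistrib K1 flip: matrix_mul_assoc)
  also have "\<dots> = X + coord T ** (\<Sigma> ** coord S) + coord S ** (\<Sigma> ** coord T)
      + coord T ** (\<Sigma> ** (sub_inv S \<Sigma> ** (\<Sigma> ** coord T)))"
    by (simp add: X_def B_def matrix_ring coord_mult coord_mult' d K0 K1 coord_sub_inv)
  also have "\<dots> = completed_block (S \<union> T) \<Sigma>"
    by (simp add: X_def B_def completed_block_eq coord_Un[OF assms] matrix_ring U_def)
  finally have "det ?L * det X * det ?R = sub_det (S \<union> T) \<Sigma>"
    by (simp add: sub_det_def flip: det_mul)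
  moreover have "det ?L = 1" "det ?R = 1"
    using det_unitriangular[of S T] det_unitriangular[of T S] assms by (auto simp: Int_commute)
  ultimately show ?thesis
    by (simp add: sub_det_def flip: X det_mul)
qed

end

section \<open>Quadratic forms of block inverses, and adding one index to a block\<close>

lemma sub_det_singleton: "sub_det {i} M = M $ i $ i"
  by (simp add: sub_det_Leibniz)

lemma coord_singleton_nth: "(M ** (coord {i} ** N)) $ j $ k = M $ j $ i * N $ i $ k"
proof -
  have "(M ** (coord {i} ** N)) $ j $ k
      = (\<Sum>l\<in>UNIV. if i = l then M $ j $ i * N $ i $ k else 0)"
    unfolding matrix_matrix_mult_def[of M] vec_lambda_beta coord_mult_nth by (intro sum.cong) auto
  then show ?thesis by simp
qed

lemma quadratic_form_sum: "x \<bullet> (M *v x) = (\<Sum>i\<in>UNIV. \<Sum>j\<in>UNIV. M $ i $ j * (x $ i * x $ j))"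
  by (simp add: inner_vec_def matrix_vector_mult_def sum_distrib_left mult_ac)

lemma positive_definite_inverse:
  assumes "positive_definite M" "M ** N = mat 1"
  shows "positive_definite N"
proof -
  have NM: "N ** M = mat 1"
    using assms(2) matrix_left_right_inverse by blast
  have "transpose N ** M = mat 1"
    using arg_cong[OF assms(2), of transpose] positive_definite_transpose[OF assms(1)]
    by (simp add: matrix_transpose_mul)
  then have N: "transpose N = N"
    by (metis NM assms(2) matrix_mul_assoc matrix_mul_lid matrix_mul_rid)
  have "0 < x \<bullet> (N *v x)" if "x \<noteq> 0" for x
  proof -
    have "M *v (N *v x) = x"
      by (simp add: matrix_vector_mul_assoc assms(2))
    then have "x \<bullet> (N *v x) = (N *v x) \<bullet> (M *v (N *v x))" and "N *v x \<noteq> 0"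
      using that by (auto simp: inner_commute)
    then show ?thesis
      using assms(1) by (simp add: positive_definite_def)
  qed
  with N show ?thesis
    by (simp add: positive_definite_def)
qed

context
  fixes \<Sigma> :: "real^'v::finite^'v"
  assumes pd: "positive_definite \<Sigma>"
begin

lemma quadratic_form_cov_nonneg: "0 \<le> x \<bullet> (\<Sigma> *v x)"
  using pd by (cases "x = 0") (auto simp: positive_definite_def less_imp_le)

text \<open>The difference G of the two inverses satisfies \<open>G ** (\<Sigma> ** G) = G\<close>,
  so its form at x is the form of \<Sigma> at \<open>G *v x\<close>.\<close>

lemma sub_inv_mono:
  assumes "S \<subseteq> T" shows "x \<bullet> (sub_inv S \<Sigma> *v x) \<le> x \<bullet> (sub_inv T \<Sigma> *v x)"
proof -
  let ?G = "sub_inv T \<Sigma> - sub_inv S \<Sigma>"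
  have "?G ** (\<Sigma> ** ?G) = ?G"
    using assms by (simp add: matrix_ring sub_inv_cov_sub_inv[OF pd])
  then have "x \<bullet> (?G *v x) = x \<bullet> (?G *v (\<Sigma> *v (?G *v x)))"
    by (simp only: matrix_vector_mul_assoc flip: matrix_mul_assoc)
  also have "\<dots> = (?G *v x) \<bullet> (\<Sigma> *v (?G *v x))"
    by (subst inner_matrix_transpose) (simp only: transpose_diff transpose_sub_inv[OF pd])
  also have "0 \<le> \<dots>"
    by (rule quadratic_form_cov_nonneg)
  finally show ?thesis
    by (simp add: matrix_vector_mult_diff_rdistrib inner_diff_right)
qed

lemma sub_inv_quadratic:
  "x \<bullet> (sub_inv S \<Sigma> *v x) = (sub_inv S \<Sigma> *v x) \<bullet> (\<Sigma> *v (sub_inv S \<Sigma> *v x))"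
proof -
  have "x \<bullet> (sub_inv S \<Sigma> *v x) = x \<bullet> (sub_inv S \<Sigma> *v (\<Sigma> *v (sub_inv S \<Sigma> *v x)))"
    by (simp only: matrix_vector_mul_assoc matrix_mul_assoc[symmetric] sub_inv_cov_sub_inv[OF pd]
        order_refl)
  then show ?thesis
    by (subst (asm) inner_matrix_transpose) (simp only: transpose_sub_inv[OF pd])
qed

lemma sub_inv_nonneg: "0 \<le> x \<bullet> (sub_inv S \<Sigma> *v x)"
  unfolding sub_inv_quadratic by (rule quadratic_form_cov_nonneg)

lemma sub_inv_definite:
  assumes "x \<bullet> (sub_inv S \<Sigma> *v x) = 0" shows "coord S *v x = 0"
proof -
  have "sub_inv S \<Sigma> *v x = 0"
  proof (rule ccontr)
    assume "sub_inv S \<Sigma> *v x \<noteq> 0"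
    then have "0 < (sub_inv S \<Sigma> *v x) \<bullet> (\<Sigma> *v (sub_inv S \<Sigma> *v x))"
      using pd unfolding positive_definite_def by blast
    then show False
      using assms by (simp only: sub_inv_quadratic[symmetric])
  qed
  then have "(coord S ** (\<Sigma> ** sub_inv S \<Sigma>)) *v x = 0"
    by (simp flip: matrix_vector_mul_assoc)
  then show ?thesis
    by (simp add: coord_cov_sub_inv[OF pd])
qed

lemma sub_inv_nth_outside: "k \<notin> S \<Longrightarrow> sub_inv S \<Sigma> $ j $ k = 0" "j \<notin> S \<Longrightarrow> sub_inv S \<Sigma> $ j $ k = 0"
  by (simp_all add: sub_inv_def sub_def)

lemma sub_inv_symmetric: "sub_inv S \<Sigma> $ j $ k = sub_inv S \<Sigma> $ k $ j"
  using arg_cong[OF transpose_sub_inv[OF pd, of S], of "\<lambda>M. M $ k $ j"] by (simp add: transpose_def)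

lemma sub_inv_diagonal_pos:
  assumes "i \<in> S" shows "0 < sub_inv S \<Sigma> $ i $ i"
proof -
  have *: "sub_inv S \<Sigma> $ i $ i = axis i 1 \<bullet> (sub_inv S \<Sigma> *v axis i 1)"
    by (simp add: inner_axis' matrix_vector_mul_component inner_axis)
  have "coord S *v axis i 1 \<noteq> 0"
    using assms by (auto simp: vec_eq_iff coord_mult_vec_nth axis_def)
  then have "axis i 1 \<bullet> (sub_inv S \<Sigma> *v axis i 1) \<noteq> 0"
    using sub_inv_definite by blast
  then show ?thesis
    using sub_inv_nonneg[of "axis i 1" S] unfolding * by (simp add: order_less_le)
qed

text \<open>Both inverses agree after multiplication by \<open>coord S ** \<Sigma>\<close>, so only
  row \<open>i\<close> of \<Sigma> times their difference survives. The difference is therefore of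
  rank one, with column \<open>i\<close> of the larger inverse as its column vector.\<close>

lemma sub_inv_insert:
  assumes "i \<notin> S"
  defines "T \<equiv> insert i S"
  shows "sub_inv T \<Sigma> $ j $ k = sub_inv S \<Sigma> $ j $ k + sub_inv T \<Sigma> $ j $ i * sub_inv T \<Sigma> $ k $ i /
      sub_inv T \<Sigma> $ i $ i"
proof -
  let ?G = "sub_inv T \<Sigma> - sub_inv S \<Sigma>"
  have ST: "S \<subseteq> T" and T: "T = S \<union> {i}" by (auto simp: T_def)
  have "coord S ** (\<Sigma> ** ?G) = 0"
    by (simp add: matrix_ring coord_cov_sub_inv[OF pd] ST)
  moreover have "coord T = coord S + coord {i}"
    unfolding T using assms(1) by (intro coord_Un) auto
  ultimately have "coord T ** (\<Sigma> ** ?G) = coord {i} ** (\<Sigma> ** ?G)"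
    by (simp add: matrix_add_rdistrib)
  then have "sub_inv T \<Sigma> ** (coord {i} ** (\<Sigma> ** ?G)) = sub_inv T \<Sigma> ** (coord T ** (\<Sigma> ** ?G))"
    by simp
  also have "\<dots> = (sub_inv T \<Sigma> ** coord T) ** (\<Sigma> ** ?G)"
    by (simp only: matrix_mul_assoc)
  also have "\<dots> = ?G"
    by (simp only: coord_sub_inv[OF pd]) (simp add: matrix_ring sub_inv_cov_sub_inv[OF pd] ST)
  finally have "sub_inv T \<Sigma> ** (coord {i} ** (\<Sigma> ** ?G)) = ?G" .
  then have G: "?G $ j $ k = sub_inv T \<Sigma> $ j $ i * (\<Sigma> ** ?G) $ i $ k" for j k
    by (metis coord_singleton_nth)
  \<comment> \<open>The smaller inverse is zero in row \<open>i\<close>; reading the rank-one form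
    there determines its unknown row vector.\<close>
  have "sub_inv T \<Sigma> $ k $ i = ?G $ i $ k"
    using assms(1) sub_inv_symmetric[of T k i] by (simp add: sub_inv_nth_outside)
  then have "(\<Sigma> ** ?G) $ i $ k = sub_inv T \<Sigma> $ k $ i / sub_inv T \<Sigma> $ i $ i"
    using G[of i k] sub_inv_diagonal_pos[of i T] by (simp add: T_def)
  with G[of j k] show ?thesis by simp
qed

text \<open>The rank-one update turns into a completed square; this square is the exponent of the
  conditional law of variable \<open>i\<close> given \<open>S\<close>.\<close>

lemma sub_inv_insert_quadratic:
  assumes "i \<notin> S"
  defines "T \<equiv> insert i S"
  shows "x \<bullet> (sub_inv T \<Sigma> *v x) = x \<bullet> (sub_inv S \<Sigma> *v x) + (\<Sum>j\<in>UNIV. sub_inv T \<Sigma> $ j $ i * x $ j)\<^sup>2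
      / sub_inv T \<Sigma> $ i $ i"
proof -
  have "(\<Sum>j\<in>UNIV. sub_inv T \<Sigma> $ j $ i * x $ j)\<^sup>2 / sub_inv T \<Sigma> $ i $ i
      = (\<Sum>j\<in>UNIV. \<Sum>k\<in>UNIV. sub_inv T \<Sigma> $ j $ i * sub_inv T \<Sigma> $ k $ i / sub_inv T \<Sigma> $ i $ i * (x $ j
          * x $ k))"
    unfolding power2_eq_square sum_product sum_divide_distrib by (intro sum.cong) auto
  moreover have "x \<bullet> (sub_inv T \<Sigma> *v x) = (\<Sum>j\<in>UNIV. \<Sum>k\<in>UNIV. sub_inv S \<Sigma> $ j $ k * (x $ j * x $ k)
      + sub_inv T \<Sigma> $ j $ i * sub_inv T \<Sigma> $ k $ i / sub_inv T \<Sigma> $ i $ i * (x $ j * x $ k))"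
    unfolding quadratic_form_sum
  proof (intro sum.cong refl)
    fix j k
    show "sub_inv T \<Sigma> $ j $ k * (x $ j * x $ k) = sub_inv S \<Sigma> $ j $ k * (x $ j * x $ k)
      + sub_inv T \<Sigma> $ j $ i * sub_inv T \<Sigma> $ k $ i / sub_inv T \<Sigma> $ i $ i * (x $ j * x $ k)"
      by (subst sub_inv_insert[OF assms(1), folded T_def]) (rule distrib_right)
  qed
  ultimately show ?thesis
    unfolding quadratic_form_sum by (simp only: sum.distrib)
qed

text \<open>The conditional variance of \<open>i\<close> given \<open>S\<close> is the reciprocal of
  the diagonal precision entry, and it is the 1 by 1 Schur complement in
  \<open>sub_det_Un\<close>.\<close>

lemma sub_det_insert:
  assumes "i \<notin> S"
  shows "sub_det (insert i S) \<Sigma> = sub_det S \<Sigma> / sub_inv (insert i S) \<Sigma> $ i $ i"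
proof -
  define T where "T = insert i S"
  let ?G = "sub_inv T \<Sigma> - sub_inv S \<Sigma>" and ?a = "\<lambda>j. sub_inv T \<Sigma> $ j $ i"
  have "coord {i} ** (\<Sigma> ** sub_inv T \<Sigma>) = coord {i}"
    by (rule coord_cov_sub_inv[OF pd]) (simp add: T_def)
  then have "(coord {i} ** (\<Sigma> ** sub_inv T \<Sigma>)) $ i $ i = coord {i} $ i $ i"
    by simp
  then have "(\<Sigma> ** sub_inv T \<Sigma>) $ i $ i = 1"
    by (simp add: coord_mult_nth) (simp add: coord_def)
  then have a: "(\<Sum>j\<in>UNIV. \<Sigma> $ i $ j * ?a j) = 1"
    by (simp add: matrix_matrix_mult_def)
  have sym: "\<Sigma> $ j $ i = \<Sigma> $ i $ j" for j
    using arg_cong[OF positive_definite_transpose[OF pd], of "\<lambda>M. M $ i $ j"]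
    by (simp add: transpose_def)
  \<comment> \<open>Row \<open>i\<close> of \<open>\<Sigma> ** sub_inv T \<Sigma>\<close> is a unit
    row. Replacing the variance this way expresses the Schur complement through the rank-one
    difference of the inverses.\<close>
  have "\<Sigma> $ i $ i = (\<Sigma> ** sub_inv T \<Sigma> ** \<Sigma>) $ i $ i"
  proof -
    have "coord {i} ** (\<Sigma> ** sub_inv T \<Sigma> ** \<Sigma>) = coord {i} ** \<Sigma>"
      using \<open>coord {i} ** (\<Sigma> ** sub_inv T \<Sigma>) = coord {i}\<close> by (simp add: matrix_mul_assoc)
    then have "(coord {i} ** (\<Sigma> ** sub_inv T \<Sigma> ** \<Sigma>)) $ i $ i = (coord {i} ** \<Sigma>) $ i $ i"
      by simp
    then show ?thesis
      by (simp add: coord_mult_nth)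
  qed
  then have "cond_cov {i} S \<Sigma> $ i $ i = (\<Sigma> ** ?G ** \<Sigma>) $ i $ i"
    by (simp add: cond_cov_eq[OF pd] coord_mult_nth mult_coord_nth matrix_diff_ldistrib
        matrix_diff_rdistrib)
  also have "\<dots> = (\<Sum>k\<in>UNIV. \<Sum>j\<in>UNIV. \<Sigma> $ i $ j * ?G $ j $ k * \<Sigma> $ k $ i)"
    by (simp only: matrix_matrix_mult_def vec_lambda_beta sum_distrib_right)
  also have "\<dots> = (\<Sum>k\<in>UNIV. \<Sum>j\<in>UNIV. (\<Sigma> $ i $ k * ?a k) * (\<Sigma> $ i $ j * ?a j) / sub_inv T \<Sigma> $ i $ i)"
  proof -
    have "\<Sigma> $ i $ j * ?G $ j $ k * \<Sigma> $ k $ i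
        = (\<Sigma> $ i $ k * ?a k) * (\<Sigma> $ i $ j * ?a j) / sub_inv T \<Sigma> $ i $ i" for j k
    proof -
      have "?G $ j $ k = ?a j * ?a k / sub_inv T \<Sigma> $ i $ i"
        unfolding vector_minus_component sub_inv_insert[OF assms, folded T_def, of j k] by linarith
      then show ?thesis
        by (simp only: sym[of k] times_divide_eq_left times_divide_eq_right mult_ac)
    qed
    then show ?thesis by simp
  qed
  also have "\<dots> = 1 / sub_inv T \<Sigma> $ i $ i"
  proof -
    have "(\<Sum>k\<in>UNIV. \<Sum>j\<in>UNIV. f k * f j / c) = sum f UNIV * sum f UNIV / c"
      for f :: "'v \<Rightarrow> real" and c
      unfolding sum_product sum_divide_distrib by (rule refl)
    then show ?thesis by (simp only: a mult_1)
  qed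
  finally have "sub_det {i} (cond_cov {i} S \<Sigma>) = 1 / sub_inv T \<Sigma> $ i $ i"
    by (simp add: sub_det_singleton)
  then show ?thesis
    using sub_det_Un[OF pd, of S "{i}"] assms by (simp add: T_def)
qed

lemma sub_det_pos: "0 < sub_det S \<Sigma>"
proof (induction S rule: finite_induct[OF finite])
  case (2 i S)
  then show ?case
    by (simp add: sub_det_insert sub_inv_diagonal_pos)
qed simp

end

section \<open>The covariance of the moment projection\<close>

text \<open>
  The change of covariance on the blocks \<open>A \<times> B\<close> and \<open>B \<times> A\<close> is propagated to the remaining
  variables by the regression of all variables on \<open>A \<union> B \<union> C\<close>.
\<close>

definition proj_change :: "'v ci \<Rightarrow> real^'v^'v \<Rightarrow> real^'v::finite^'v" where
  "proj_change = (\<lambda>(A, B, C) M.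
    let F = M - M ** sub_inv C M ** M
    in coord A ** F ** coord B + coord B ** F ** coord A)"

definition proj_cov :: "'v ci \<Rightarrow> real^'v^'v \<Rightarrow> real^'v::finite^'v" where
  "proj_cov = (\<lambda>(A, B, C) M.
    M - M ** sub_inv (A \<union> B \<union> C) M ** proj_change (A, B, C) M ** sub_inv (A \<union> B \<union> C) M ** M)"

text \<open>The exponent matrix of p(A,C) p(B,C) / p(C), which will be the inverse of the projected
  block on \<open>A \<union> B \<union> C\<close>.\<close>

definition proj_prec :: "'v ci \<Rightarrow> real^'v^'v \<Rightarrow> real^'v::finite^'v" where
  "proj_prec = (\<lambda>(A, B, C) M. sub_inv (A \<union> C) M + sub_inv (B \<union> C) M - sub_inv C M)"

text \<open>Products are normalized to right-nested form, so a rule on adjacent factors needs a copy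
  with a tail \<open>X\<close> to fire inside a longer product.\<close>

lemma matrix_mult_nested:
  fixes M :: "real^'v^'v::finite"
  shows "M1 ** M2 = M3 \<Longrightarrow> M1 ** (M2 ** X) = M3 ** X"
    and "M1 ** (M2 ** M3) = M4 \<Longrightarrow> M1 ** (M2 ** (M3 ** X)) = M4 ** X"
  by (simp_all add: matrix_mul_assoc)

section \<open>Precision and definiteness of the projected covariance\<close>

context
  fixes \<Sigma> :: "real^'v::finite^'v" and A B C :: "'v set"
  assumes pd: "positive_definite \<Sigma>"
    and disjoint: "A \<inter> B = {}" "A \<inter> C = {}" "B \<inter> C = {}"
begin

private abbreviation (input) "K S \<equiv> sub_inv S \<Sigma>"
private abbreviation (input) "Y \<equiv> A \<union> B \<union> C"
private abbreviation (input) "H \<equiv> proj_change (A, B, C) \<Sigma>"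
private abbreviation (input) "Sp \<equiv> proj_cov (A, B, C) \<Sigma>"
private abbreviation (input) "N \<equiv> proj_prec (A, B, C) \<Sigma>"

private lemmas cov_rules =
  sub_inv_cov_sub_inv[OF pd] coord_cov_sub_inv[OF pd] sub_inv_cov_coord[OF pd]
  sub_inv_cov_sub_inv[OF pd, THEN matrix_mult_nested(2)]
  coord_cov_sub_inv[OF pd, THEN matrix_mult_nested(2)]
  sub_inv_cov_coord[OF pd, THEN matrix_mult_nested(2)]
  coord_sub_inv_subset[OF pd] coord_sub_inv_subset[OF pd, THEN matrix_mult_nested(1)]
  coord_sub_inv_disjoint[OF pd] coord_sub_inv_disjoint[OF pd, THEN matrix_mult_nested(1)]
  coord_mult coord_mult'

private lemma disjoint': "B \<inter> A = {}" "C \<inter> A = {}" "C \<inter> B = {}"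
  using disjoint by auto

private lemma coord_Y: "coord Y = coord A + coord B + coord C"
  using disjoint by (simp add: coord_Un Int_Un_distrib2)

private lemma coord_AC: "coord (A \<union> C) = coord A + coord C"
  and coord_BC: "coord (B \<union> C) = coord B + coord C"
  using disjoint by (simp_all add: coord_Un)

text \<open>For the last claim: such an \<open>S\<close> misses \<open>A\<close> or
  \<open>B\<close>, and each summand of the change has a factor on both.\<close>

lemma change_support: "coord Y ** H = H" "H ** coord Y = H"
  "coord S ** H ** coord S = 0" if "S \<subseteq> A \<union> C \<or> S \<subseteq> B \<union> C"
proof -
  show "coord Y ** H = H" "H ** coord Y = H"
    by (simp_all add: proj_change_def Let_def matrix_ring coord_Y cov_rules disjoint disjoint')
  have "S \<inter> A = {} \<or> S \<inter> B = {}"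
    using that disjoint by auto
  then show "coord S ** H ** coord S = 0"
    by (auto simp add: proj_change_def Let_def matrix_ring cov_rules Int_commute)
qed

lemma change_C: "coord C ** H = 0" "H ** coord C = 0"
  by (simp_all add: proj_change_def Let_def matrix_ring cov_rules disjoint disjoint')

lemma transpose_change: "transpose H = H"
  by (simp add: proj_change_def Let_def transpose_add transpose_diff matrix_transpose_mul
      matrix_ring
      positive_definite_transpose[OF pd] transpose_sub_inv[OF pd] add.commute)

text \<open>Rearranged, this says that \<open>N\<close> inverts the modified block
  \<open>\<Sigma> - H\<close> on \<open>Y\<close>.\<close>

lemma prec_change: "N ** H = N ** (\<Sigma> ** coord Y) - coord Y"
proof -
  let ?F = "\<Sigma> - \<Sigma> ** K C ** \<Sigma>"
  have CF: "coord C ** ?F = 0"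
    by (simp add: matrix_ring cov_rules)
  have "K (A \<union> C) ** H = (K (A \<union> C) ** coord (A \<union> C)) ** H"
    by (simp add: coord_sub_inv[OF pd])
  \<comment> \<open>The residual \<open>?F\<close> vanishes on the rows \<open>C\<close>, so these
    rows may be added; the projection becomes \<open>coord (A \<union> C)\<close>, which
    \<open>K (A \<union> C)\<close> absorbs.\<close>
  also have "\<dots> = K (A \<union> C) ** ((coord A + coord C) ** ?F ** coord B)"
    using CF disjoint
    by (simp add: coord_AC proj_change_def Let_def matrix_mul_assoc[symmetric] matrix_add_ldistrib
        matrix_add_rdistrib coord_mult' matrix_mult_zero disjoint')
  also have "\<dots> = K (A \<union> C) ** (\<Sigma> ** coord B) - K C ** (\<Sigma> ** coord B)"
    by (simp add: matrix_ring cov_rules flip: coord_AC)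
  finally have 1: "K (A \<union> C) ** H = K (A \<union> C) ** (\<Sigma> ** coord B) - K C ** (\<Sigma> ** coord B)" .
  have "K (B \<union> C) ** H = (K (B \<union> C) ** coord (B \<union> C)) ** H"
    by (simp add: coord_sub_inv[OF pd])
  also have "\<dots> = K (B \<union> C) ** ((coord B + coord C) ** ?F ** coord A)"
    using CF disjoint
    by (simp add: coord_BC proj_change_def Let_def matrix_mul_assoc[symmetric] matrix_add_ldistrib
        matrix_add_rdistrib coord_mult' matrix_mult_zero disjoint')
  also have "\<dots> = K (B \<union> C) ** (\<Sigma> ** coord A) - K C ** (\<Sigma> ** coord A)"
    by (simp add: matrix_ring cov_rules flip: coord_BC)
  finally have 2: "K (B \<union> C) ** H = K (B \<union> C) ** (\<Sigma> ** coord A) - K C ** (\<Sigma> ** coord A)" .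
  have 3: "K C ** H = 0"
    by (metis change_C(1) coord_sub_inv(2)[OF pd] matrix_mul_assoc matrix_mult_zero(1))
  show ?thesis
    by (simp add: proj_prec_def matrix_diff_rdistrib matrix_add_rdistrib 1 2 3)
       (simp add: coord_Y matrix_ring cov_rules)
qed

lemma prec_Y: "coord Y ** N = N" "N ** coord Y = N" "K Y ** (\<Sigma> ** N) = N" "N ** (\<Sigma> ** K Y) = N"
  by (simp_all add: proj_prec_def matrix_ring cov_rules Un_ac subset_iff)

lemma proj_prec_cov: "(N + (K UNIV - K Y)) ** Sp = mat 1"
proof -
  have U: "K UNIV ** \<Sigma> = mat 1"
    using sub_inv_cov_coord[OF pd, of UNIV UNIV] by simp
  \<comment> \<open>Acting on \<open>\<Sigma> ** K Y\<close>, the terms \<open>K UNIV\<close> and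
    \<open>- K Y\<close> leave \<open>K Y\<close> and \<open>- K Y\<close>, so only
    \<open>N ** H\<close> remains for \<open>prec_change\<close>.\<close>
  have "(N + (K UNIV - K Y)) ** Sp
     = N ** \<Sigma> + mat 1 - K Y ** \<Sigma> - (N + K Y - K Y) ** (H ** (K Y ** \<Sigma>))"
    by (simp add: proj_cov_def matrix_ring cov_rules prec_Y(3,4)[THEN matrix_mult_nested(2)] U
        U[THEN matrix_mult_nested(1)])
  also have "(N + K Y - K Y) ** (H ** (K Y ** \<Sigma>)) = (N ** (\<Sigma> ** coord Y) - coord Y) ** (K Y ** \<Sigma>)"
    by (simp add: prec_change matrix_mul_assoc)
  also have "\<dots> = N ** \<Sigma> - K Y ** \<Sigma>"
    by (simp add: matrix_ring cov_rules prec_Y(4)[THEN matrix_mult_nested(2)])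
  finally show ?thesis by simp
qed

lemma transpose_proj_prec: "transpose N = N"
  by (simp add: proj_prec_def transpose_add transpose_diff transpose_sub_inv[OF pd])

text \<open>The form is the sum of three increments belonging to (A,C), to B given C, and to the
  rest given Y, nonnegative by \<open>sub_inv_mono\<close>. If all are zero, the vector vanishes on
  \<open>A \<union> C\<close>, then on \<open>B \<union> C\<close>, then everywhere.\<close>

lemma positive_definite_proj_prec: "positive_definite (N + (K UNIV - K Y))"
  unfolding positive_definite_def
proof (intro conjI allI impI)
  show "transpose (N + (K UNIV - K Y)) = N + (K UNIV - K Y)"
    by (simp add: transpose_add transpose_diff transpose_proj_prec transpose_sub_inv[OF pd])
  fix x :: "real^'v" assume "x \<noteq> 0"
  define q where "q S = x \<bullet> (K S *v x)" for S
  have eq: "x \<bullet> ((N + (K UNIV - K Y)) *v x) = q (A \<union> C) + (q (B \<union> C) - q C) + (q UNIV - q Y)"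
    by (simp add: q_def proj_prec_def matrix_vector_mult_add_rdistrib
        matrix_vector_mult_diff_rdistrib
        inner_add_right inner_diff_right)
  have mono: "q S \<le> q T" if "S \<subseteq> T" for S T
    unfolding q_def by (rule sub_inv_mono[OF pd that])
  have zero: "coord S *v x = 0" if "q S = 0" for S
    using sub_inv_definite[OF pd] that by (simp add: q_def)
  have q0: "q S = 0" if "coord S *v x = 0" for S
    unfolding q_def by (metis coord_sub_inv(2)[OF pd] inner_zero_right matrix_vector_mul_assoc
        matrix_vector_mult_0_right that)
  have ge: "0 \<le> q (A \<union> C)" "q C \<le> q (B \<union> C)" "q Y \<le> q UNIV"
    using sub_inv_nonneg[OF pd] by (auto simp: q_def intro!: mono[unfolded q_def])
  show "0 < x \<bullet> ((N + (K UNIV - K Y)) *v x)"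
  proof (rule ccontr)
    assume "\<not> ?thesis"
    then have "q (A \<union> C) = 0" "q (B \<union> C) = q C" "q UNIV = q Y"
      using ge unfolding eq by linarith+
    then have AC: "coord (A \<union> C) *v x = 0"
      by (simp add: zero)
    then have "coord C *v x = 0"
      by (auto simp: vec_eq_iff coord_mult_vec_nth split: if_splits)
    then have "coord (B \<union> C) *v x = 0"
      using \<open>q (B \<union> C) = q C\<close> by (simp add: zero q0)
    with AC have "coord Y *v x = 0"
      by (auto simp: vec_eq_iff coord_mult_vec_nth split: if_splits)
    then have "coord UNIV *v x = 0"
      using \<open>q UNIV = q Y\<close> zero q0 by metis
    with \<open>x \<noteq> 0\<close> show False by simp
  qed
qed

text \<open>The covariance is given as a difference, which hides its sign; definiteness is inherited
  from its inverse.\<close>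

lemma positive_definite_proj_cov: "positive_definite Sp"
  using positive_definite_inverse[OF positive_definite_proj_prec proj_prec_cov] .

lemma sub_inv_proj_cov: "sub_inv Y Sp = N"
proof (rule sub_inv_unique[OF positive_definite_proj_cov, symmetric])
  have "transpose (N ** H) = transpose (N ** (\<Sigma> ** coord Y) - coord Y)"
    by (simp add: prec_change)
  then have "H ** N = coord Y ** (\<Sigma> ** N) - coord Y"
    by (simp add: matrix_transpose_mul transpose_change transpose_proj_prec transpose_diff
        positive_definite_transpose[OF pd] matrix_mul_assoc)
  then show "coord Y ** (Sp ** N) = coord Y"
    by (simp add: proj_cov_def matrix_ring cov_rules prec_Y change_support
        change_support(1)[THEN matrix_mult_nested(1)])
  show "coord Y ** N = N"
    by (rule prec_Y)
qed

lemma sub_inv_UNIV_proj_cov: "sub_inv UNIV Sp = N + (K UNIV - K Y)"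
proof (rule sub_inv_unique[OF positive_definite_proj_cov, symmetric])
  show "coord UNIV ** (Sp ** (N + (K UNIV - K Y))) = coord UNIV"
    using proj_prec_cov matrix_left_right_inverse by (simp add: matrix_left_right_inverse)
qed simp

section \<open>Blocks, Schur complements and determinants of the projected covariance\<close>

lemma proj_cov_blocks:
  assumes "S \<subseteq> Y" "T \<subseteq> Y"
  shows "coord S ** (Sp ** coord T) = coord S ** (\<Sigma> ** coord T) - coord S ** (H ** coord T)"
  using assms by (simp add: proj_cov_def matrix_ring cov_rules)

lemma proj_cov_block_same:
  assumes "S \<subseteq> A \<union> C \<or> S \<subseteq> B \<union> C"
  shows "sub S S Sp = sub S S \<Sigma>"
proof -
  have "S \<subseteq> Y" using assms by auto
  then show ?thesis
    using proj_cov_blocks[of S S] change_support(3)[OF assms] by (simp add: sub_eq matrix_ring)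
qed

lemma proj_cov_col_C: "Sp ** coord C = \<Sigma> ** coord C"
proof -
  have "H ** (K Y ** (\<Sigma> ** coord C)) = 0"
    by (simp add: cov_rules change_C subset_iff)
  then show ?thesis
    by (simp add: proj_cov_def matrix_ring)
qed

lemma proj_cov_row_C: "coord C ** Sp = coord C ** \<Sigma>"
  using arg_cong[OF proj_cov_col_C, of transpose]
    positive_definite_transpose[OF pd] positive_definite_transpose[OF positive_definite_proj_cov]
  by (simp add: matrix_transpose_mul)

lemma proj_cov_AB:
  "coord A ** (Sp ** coord B) = coord A ** (\<Sigma> ** (K C ** (\<Sigma> ** coord B)))"
  "coord B ** (Sp ** coord A) = coord B ** (\<Sigma> ** (K C ** (\<Sigma> ** coord A)))"
  by (subst proj_cov_blocks; auto simp add: proj_change_def Let_def matrix_ring cov_rules disjoint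
      disjoint')+

lemma prec_mult_proj_cov: "N ** Sp = K Y ** \<Sigma>" "Sp ** N = \<Sigma> ** K Y"
proof -
  have "N ** Sp = N ** \<Sigma> - (N ** H) ** (K Y ** \<Sigma>)"
    by (simp add: proj_cov_def matrix_ring cov_rules prec_Y[THEN matrix_mult_nested(1)]
        prec_Y(4)[THEN matrix_mult_nested(2)])
  then show *: "N ** Sp = K Y ** \<Sigma>"
    by (simp add: prec_change matrix_ring cov_rules prec_Y(4)[THEN matrix_mult_nested(2)])
  show "Sp ** N = \<Sigma> ** K Y"
    using arg_cong[OF *, of transpose] positive_definite_transpose[OF pd]
      positive_definite_transpose[OF positive_definite_proj_cov]
    by (simp add: matrix_transpose_mul transpose_proj_prec transpose_sub_inv[OF pd])
qed

text \<open>The change \<open>Sp - \<Sigma>\<close> ends in the factor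
  \<open>K Y ** \<Sigma>\<close>, which is idempotent.\<close>

lemma proj_cov_regression: "Sp ** (K Y ** \<Sigma>) = \<Sigma> ** (K Y ** \<Sigma>) + Sp - \<Sigma>"
  by (simp add: proj_cov_def matrix_ring cov_rules)

text \<open>Keeping the conditional law given \<open>Y\<close> keeps the regression coefficients
  \<open>\<Sigma> ** K Y\<close>, so the cross blocks follow the new block on
  \<open>Y\<close>.\<close>

lemma proj_cov_XY:
  "sub S Y Sp = sub S Y \<Sigma> ** K Y ** sub Y Y Sp"
  "sub Y S Sp = sub Y Y Sp ** K Y ** sub Y S \<Sigma>"
proof -
  have "Sp ** coord Y = \<Sigma> ** (K Y ** (Sp ** coord Y))"
    by (simp add: proj_cov_def matrix_ring cov_rules)
  then show *: "sub S Y Sp = sub S Y \<Sigma> ** K Y ** sub Y Y Sp" for S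
    by (simp add: sub_eq matrix_ring cov_rules)
  show "sub Y S Sp = sub Y Y Sp ** K Y ** sub Y S \<Sigma>"
    using arg_cong[OF *[of S], of transpose] positive_definite_transpose[OF pd]
      positive_definite_transpose[OF positive_definite_proj_cov]
    by (simp add: sub_eq matrix_transpose_mul transpose_sub_inv[OF pd] matrix_mul_assoc)
qed

text \<open>A resolvent identity: \<open>Sp ** N = \<Sigma> ** K Y\<close> turns
  \<open>Sp ** ((N - K Y) ** \<Sigma>)\<close> into \<open>\<Sigma> - Sp\<close>. Hence the minus
  sign, and one cross block from each of the two covariances.\<close>

lemma proj_cov_XX:
  "sub S S Sp = sub S S \<Sigma> - sub S Y Sp ** (sub_inv Y Sp - K Y) ** sub Y S \<Sigma>"
proof -
  have "Sp ** ((N - K Y) ** \<Sigma>) = \<Sigma> - Sp"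
    using prec_mult_proj_cov(2)
    by (simp add: matrix_ring proj_cov_regression prec_mult_proj_cov(2)[THEN matrix_mult_nested(1)])
  moreover have "coord Y ** (N - K Y) ** coord Y = N - K Y"
    by (simp add: matrix_ring prec_Y cov_rules)
  moreover have "sub S Y Sp ** (N - K Y) ** sub Y S \<Sigma>
      = coord S ** (Sp ** ((coord Y ** (N - K Y) ** coord Y) ** \<Sigma>)) ** coord S"
    by (simp only: sub_eq matrix_mul_assoc)
  ultimately show ?thesis
    by (simp add: sub_inv_proj_cov) (simp add: sub_eq matrix_ring)
qed

lemma sub_proj_cov_AB:
  "sub A B Sp = sub A C \<Sigma> ** K C ** sub C B \<Sigma>"
  "sub B A Sp = sub B C \<Sigma> ** K C ** sub C A \<Sigma>"
  using proj_cov_AB by (simp_all add: sub_eq matrix_ring cov_rules)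

lemma proj_cov_support:
  assumes "Sp $ i $ j \<noteq> \<Sigma> $ i $ j"
  shows "(i, j) \<in> A \<times> B \<union> B \<times> A \<union> (UNIV - Y) \<times> (A \<union> B) \<union> (A \<union> B) \<times> (UNIV - Y)
    \<union> (UNIV - Y) \<times> (UNIV - Y)"
proof -
  have "j \<notin> C"
    using arg_cong[OF proj_cov_col_C, of "\<lambda>M. M $ i $ j"] assms by (auto simp: mult_coord_nth)
  moreover have "i \<notin> C"
    using arg_cong[OF proj_cov_row_C, of "\<lambda>M. M $ i $ j"] assms by (auto simp: coord_mult_nth)
  moreover have "\<not> (i \<in> S \<and> j \<in> S)" if "S = A \<or> S = B" for S
    using arg_cong[OF proj_cov_block_same[of S], of "\<lambda>M. M $ i $ j"] assms that
    by (auto simp: sub_def)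
  ultimately show ?thesis by blast
qed

text \<open>The matrix form of keeping the conditional law given \<open>Y\<close>: the residual of
  the regression on \<open>Y\<close> does not see the change.\<close>

lemma cond_cov_proj_cov: "cond_cov S Y Sp = cond_cov S Y \<Sigma>"
proof -
  have "Sp - Sp ** sub_inv Y Sp ** Sp = \<Sigma> - \<Sigma> ** K Y ** \<Sigma>"
    by (simp add: sub_inv_proj_cov prec_mult_proj_cov(1) matrix_ring proj_cov_regression)
  then show ?thesis
    by (simp only: cond_cov_eq[OF pd] cond_cov_eq[OF positive_definite_proj_cov])
qed

text \<open>After the projection \<open>A\<close> tells nothing about \<open>B\<close> beyond
  \<open>C\<close>, so conditioning on \<open>A \<union> C\<close> has the effect of conditioning on
  \<open>C\<close>.\<close>

lemma cond_cov_proj_cov_B: "cond_cov B (A \<union> C) Sp = cond_cov B C \<Sigma>"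
proof -
  have K: "sub_inv (A \<union> C) Sp = K (A \<union> C)"
    by (rule sub_inv_cong) (simp add: proj_cov_block_same)
  have BB: "coord B ** (Sp ** coord B) = coord B ** (\<Sigma> ** coord B)"
    using proj_cov_block_same[of B] by (simp add: sub_eq matrix_ring)
  \<comment> \<open>On the rows \<open>A\<close> this is the new cross block; on the rows
    \<open>C\<close> nothing changed, and there \<open>\<Sigma> ** (K C ** \<Sigma>)\<close> agrees
    with \<Sigma>.\<close>
  have AB: "coord (A \<union> C) ** (Sp ** coord B) = coord (A \<union> C) ** (\<Sigma> ** (K C ** (\<Sigma> ** coord B)))"
    unfolding coord_AC matrix_add_rdistrib
    by (simp add: proj_cov_AB cov_rules proj_cov_row_C[THEN matrix_mult_nested(1)]
        flip: matrix_mul_assoc)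
  have BA: "coord B ** (Sp ** coord (A \<union> C)) = coord B ** (\<Sigma> ** (K C ** (\<Sigma> ** coord (A \<union> C))))"
    unfolding coord_AC matrix_add_ldistrib
    by (simp add: proj_cov_AB cov_rules proj_cov_col_C)
  have "coord B ** (Sp ** (K (A \<union> C) ** (Sp ** coord B)))
      = (coord B ** (Sp ** coord (A \<union> C))) ** (K (A \<union> C) ** (coord (A \<union> C) ** (Sp ** coord B)))"
    by (simp add: matrix_ring coord_sub_inv[OF pd] coord_sub_inv[OF pd, THEN matrix_mult_nested(1)])
  also have "\<dots> = coord B ** (\<Sigma> ** (K C ** (\<Sigma> ** coord B)))"
    unfolding AB BA by (simp add: matrix_ring cov_rules subset_iff)
  finally show ?thesis
    by (simp add: cond_cov_eq[OF pd] cond_cov_eq[OF positive_definite_proj_cov] K matrix_ring BB)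
qed

text \<open>These identities balance the normalizing constants in the factorization of the candidate
  density.\<close>

lemma sub_det_proj_cov:
  "sub_det Y Sp * sub_det C \<Sigma> = sub_det (A \<union> C) \<Sigma> * sub_det (B \<union> C) \<Sigma>"
  "sub_det UNIV Sp * sub_det Y \<Sigma> = sub_det UNIV \<Sigma> * sub_det Y Sp"
proof -
  have 1: "sub_det (A \<union> C) Sp = sub_det (A \<union> C) \<Sigma>"
    by (rule sub_det_cong) (simp add: proj_cov_block_same)
  have "sub_det Y Sp = sub_det (A \<union> C) Sp * sub_det B (cond_cov B (A \<union> C) Sp)"
    using sub_det_Un[OF positive_definite_proj_cov, of "A \<union> C" B] disjoint disjoint'
    by (simp add: Int_Un_distrib2 Un_ac)
  moreover have "sub_det (B \<union> C) \<Sigma> = sub_det C \<Sigma> * sub_det B (cond_cov B C \<Sigma>)"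
    using sub_det_Un[OF pd, of C B] disjoint' by (simp add: Un_ac)
  ultimately show "sub_det Y Sp * sub_det C \<Sigma> = sub_det (A \<union> C) \<Sigma> * sub_det (B \<union> C) \<Sigma>"
    by (simp add: 1 cond_cov_proj_cov_B)
  have "Y \<union> (UNIV - Y) = UNIV" "Y \<inter> (UNIV - Y) = {}"
    by auto
  then show "sub_det UNIV Sp * sub_det Y \<Sigma> = sub_det UNIV \<Sigma> * sub_det Y Sp"
    using sub_det_Un[OF positive_definite_proj_cov, of Y "UNIV - Y"]
      sub_det_Un[OF pd, of Y "UNIV - Y"]
    by (simp only: cond_cov_proj_cov) simp
qed

end

section \<open>Gaussian densities\<close>

text \<open>A function of the full outcome although it depends only on the coordinates in
  \<open>S\<close>, so that densities of different blocks can be multiplied pointwise.\<close>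

definition gauss_dens :: "real^'v \<Rightarrow> real^'v^'v \<Rightarrow> 'v set \<Rightarrow> ('v::finite \<Rightarrow> real) \<Rightarrow> real" where
  "gauss_dens \<mu> \<Sigma> S x =
    exp (- (1/2) * (((\<chi> i. x i) - \<mu>) \<bullet> (sub_inv S \<Sigma> *v ((\<chi> i. x i) - \<mu>))))
      / sqrt ((2 * pi) ^ card S * sub_det S \<Sigma>)"

interpretation lborel: product_sigma_finite "\<lambda>_ :: 'v. lborel :: real measure"
  by standard

lemma gaussian_density: "gaussian \<mu> \<Sigma> = density (leb UNIV) (gauss_dens \<mu> \<Sigma> UNIV)"
  by (simp add: gaussian_def gauss_dens_def sub_inv_UNIV sub_det_UNIV)

lemma gauss_dens_exponent:
  "((\<chi> i. x i) - \<mu>) \<bullet> (sub_inv S \<Sigma> *v ((\<chi> i. x i) - \<mu>))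
    = (\<Sum>i\<in>S. \<Sum>j\<in>S. sub_inv S \<Sigma> $ i $ j * ((x i - \<mu> $ i) * (x j - \<mu> $ j)))"
proof -
  have "((\<chi> i. x i) - \<mu>) \<bullet> (sub_inv S \<Sigma> *v ((\<chi> i. x i) - \<mu>))
      = (\<Sum>i\<in>UNIV. \<Sum>j\<in>UNIV. sub_inv S \<Sigma> $ i $ j * ((x i - \<mu> $ i) * (x j - \<mu> $ j)))"
    by (simp add: quadratic_form_sum)
  also have "\<dots> = (\<Sum>i\<in>S. \<Sum>j\<in>UNIV. sub_inv S \<Sigma> $ i $ j * ((x i - \<mu> $ i) * (x j - \<mu> $ j)))"
    by (rule sum.mono_neutral_right) (auto simp: sub_inv_def sub_def)
  also have "\<dots> = (\<Sum>i\<in>S. \<Sum>j\<in>S. sub_inv S \<Sigma> $ i $ j * ((x i - \<mu> $ i) * (x j - \<mu> $ j)))"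
    by (intro sum.cong refl sum.mono_neutral_right) (auto simp: sub_inv_def sub_def)
  finally show ?thesis .
qed

lemma gauss_dens_cong: "(\<And>i. i \<in> S \<Longrightarrow> x i = y i) \<Longrightarrow> gauss_dens \<mu> \<Sigma> S x = gauss_dens \<mu> \<Sigma> S y"
  unfolding gauss_dens_def gauss_dens_exponent by simp

lemma gauss_dens_restrict [simp]: "gauss_dens \<mu> \<Sigma> S (restrict x S) = gauss_dens \<mu> \<Sigma> S x"
  by (rule gauss_dens_cong) simp

lemma measurable_gauss_dens:
  assumes "S \<subseteq> T" shows "gauss_dens \<mu> \<Sigma> S \<in> borel_measurable (leb T)"
proof -
  have [measurable]: "(\<lambda>x. x i) \<in> borel_measurable (leb T)" if "i \<in> S" for i
    using measurable_component_singleton[of i T "\<lambda>_. lborel"] that assms by auto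
  show ?thesis
    unfolding gauss_dens_def gauss_dens_exponent by measurable
qed

lemma measurable_restrict_leb: "S \<subseteq> T \<Longrightarrow> (\<lambda>x. restrict x S) \<in> measurable (leb T) (leb S)"
  by (rule measurable_restrict_subset)

lemma restrict_space_leb: "x \<in> space (leb S) \<Longrightarrow> restrict x S = x"
  by (auto simp: space_PiM PiE_restrict)

section \<open>Marginals of a Gaussian\<close>

context
  fixes \<mu> :: "real^'v::finite" and \<Sigma> :: "real^'v^'v"
  assumes pd: "positive_definite \<Sigma>"
begin

lemma gauss_dens_pos: "0 < gauss_dens \<mu> \<Sigma> S x"
  by (simp add: gauss_dens_def sub_det_pos[OF pd])

lemma gauss_dens_empty: "gauss_dens \<mu> \<Sigma> {} x = 1"
  by (simp add: gauss_dens_def gauss_dens_exponent)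

text \<open>The regression of variable \<open>i\<close> on \<open>S\<close>, written through the
  precision of \<open>insert i S\<close>: the center of the completed square.\<close>

definition cond_mean :: "'v \<Rightarrow> 'v set \<Rightarrow> ('v \<Rightarrow> real) \<Rightarrow> real" where
  "cond_mean i S x = \<mu> $ i - (\<Sum>j\<in>S. sub_inv (insert i S) \<Sigma> $ j $ i * (x j - \<mu> $ j)) / sub_inv
      (insert i S) \<Sigma> $ i $ i"

text \<open>The chain rule for one further variable: the completed square supplies the conditional
  normal exponent and \<open>sub_det_insert\<close> its constant.\<close>

lemma gauss_dens_insert:
  assumes "i \<notin> S"
  shows "gauss_dens \<mu> \<Sigma> (insert i S) (x(i := t))
    = gauss_dens \<mu> \<Sigma> S x * normal_density (cond_mean i S x) (1 / sqrt (sub_inv (insert i S) \<Sigma> $ i $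
        i)) t"
proof -
  define T where "T = insert i S"
  define k where "k = sub_inv T \<Sigma> $ i $ i"
  have k: "0 < k"
    unfolding k_def by (rule sub_inv_diagonal_pos[OF pd]) (simp add: T_def)
  define y where "y = x(i := t)"
  let ?v = "(\<chi> j. y j) - \<mu>"
  have S: "?v \<bullet> (sub_inv S \<Sigma> *v ?v) = ((\<chi> j. x j) - \<mu>) \<bullet> (sub_inv S \<Sigma> *v ((\<chi> j. x j) - \<mu>))"
    unfolding gauss_dens_exponent using assms by (intro sum.cong) (auto simp: y_def)
  have "(\<Sum>j\<in>UNIV. sub_inv T \<Sigma> $ j $ i * ?v $ j) = (\<Sum>j\<in>T. sub_inv T \<Sigma> $ j $ i * (y j - \<mu> $ j))"
    by (subst sum.mono_neutral_right[of UNIV T]) (auto simp: sub_inv_def sub_def)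
  also have "\<dots> = k * (t - \<mu> $ i) + (\<Sum>j\<in>S. sub_inv T \<Sigma> $ j $ i * (x j - \<mu> $ j))"
  proof -
    have "(\<Sum>j\<in>S. sub_inv T \<Sigma> $ j $ i * (y j - \<mu> $ j)) = (\<Sum>j\<in>S. sub_inv T \<Sigma> $ j $ i * (x j - \<mu> $ j))"
      using assms by (intro sum.cong) (auto simp: y_def)
    then show ?thesis
      using assms by (simp add: T_def k_def y_def)
  qed
  also have "\<dots> = k * (t - cond_mean i S x)"
    using k by (simp add: cond_mean_def field_simps flip: T_def k_def)
  finally have T: "?v \<bullet> (sub_inv T \<Sigma> *v ?v)
      = ((\<chi> j. x j) - \<mu>) \<bullet> (sub_inv S \<Sigma> *v ((\<chi> j. x j) - \<mu>)) + k * (t - cond_mean i S x)\<^sup>2"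
    using sub_inv_insert_quadratic[OF pd assms, of ?v] k
    by (simp add: S power2_eq_square flip: T_def k_def)
  have "sqrt ((2 * pi) ^ card T * sub_det T \<Sigma>)
      = sqrt ((2 * pi) ^ card S * sub_det S \<Sigma>) * sqrt (2 * pi / k)"
    using assms by (simp add: T_def sub_det_insert[OF pd] k_def real_sqrt_mult real_sqrt_divide)
  moreover have "normal_density (cond_mean i S x) (1 / sqrt k) t
      = exp (- (1/2) * (k * (t - cond_mean i S x)\<^sup>2)) / sqrt (2 * pi / k)"
    using k by (simp add: normal_density_def power_divide)
  ultimately show ?thesis
    by (simp add: gauss_dens_def T ring_distribs mult_exp_exp flip: T_def k_def y_def)
qed

lemma nn_integral_gauss_dens_insert:
  assumes "i \<notin> S"
  shows "(\<integral>\<^sup>+ t. ennreal (gauss_dens \<mu> \<Sigma> (insert i S) (x(i := t))) \<partial>lborel) = ennreal (gauss_dens \<mu>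
      \<Sigma> S x)"
proof -
  have k: "0 < sub_inv (insert i S) \<Sigma> $ i $ i"
    by (rule sub_inv_diagonal_pos[OF pd]) simp
  interpret N: prob_space
    "density lborel (normal_density (cond_mean i S x) (1 / sqrt (sub_inv (insert i S) \<Sigma> $ i $ i)))"
    using k by (intro prob_space_normal_density) simp
  have "(\<integral>\<^sup>+ t. ennreal (normal_density (cond_mean i S x) (1 / sqrt (sub_inv (insert i S) \<Sigma> $ i $
      i)) t) \<partial>lborel) = 1"
    using N.emeasure_space_1 by (simp add: emeasure_density)
  then show ?thesis
    by (simp add: gauss_dens_insert[OF assms] ennreal_mult' less_imp_le[OF gauss_dens_pos]
        nn_integral_cmult)
qed

lemma marginal_gaussian: "marginal (gaussian \<mu> \<Sigma>) S = density (leb S) (gauss_dens \<mu> \<Sigma> S)"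
proof -
  \<comment> \<open>Induction on the complement integrates the coordinates out one at a time,
    starting from the full law.\<close>
  have "marginal (gaussian \<mu> \<Sigma>) (- U) = density (leb (- U)) (gauss_dens \<mu> \<Sigma> (- U))" for U
  proof (induction U rule: finite_induct[OF finite])
    case 1
    have "marginal (gaussian \<mu> \<Sigma>) UNIV = distr (gaussian \<mu> \<Sigma>) (gaussian \<mu> \<Sigma>) (\<lambda>x. x)"
      unfolding marginal_def by (rule distr_cong) (auto simp: gaussian_density)
    then show ?case
      by (simp add: gaussian_density)
  next
    case (2 i U)
    define S T where "S = - insert i U" and "T = - U"
    have T: "T = insert i S" and i: "i \<notin> S" and ST: "S \<subseteq> T"
      using 2 by (auto simp: S_def T_def)
    note [measurable] = measurable_restrict_leb[OF ST] measurable_gauss_dens[of S S]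
        measurable_gauss_dens[of T T]
    have "marginal (gaussian \<mu> \<Sigma>) S = distr (marginal (gaussian \<mu> \<Sigma>) T) (leb S) (\<lambda>x. restrict x S)"
      unfolding marginal_def
      by (subst distr_distr)
         (use ST in \<open>auto simp: comp_def gaussian_density restrict_restrict Int_absorb1
             measurable_restrict_leb intro!: distr_cong\<close>)
    also have "\<dots> = distr (density (leb T) (gauss_dens \<mu> \<Sigma> T)) (leb S) (\<lambda>x. restrict x S)"
      using 2 by (simp add: T_def)
    also have "\<dots> = density (leb S) (gauss_dens \<mu> \<Sigma> S)"
    proof (rule measure_eqI)
      fix A assume "A \<in> sets (distr (density (leb T) (gauss_dens \<mu> \<Sigma> T)) (leb S) (\<lambda>x. restrict x
          S))"
      then have A[measurable]: "A \<in> sets (leb S)" by simp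
      have A': "(\<lambda>x. restrict x S) -` A \<inter> space (leb T) \<in> sets (leb T)"
        by measurable
      have "emeasure (distr (density (leb T) (gauss_dens \<mu> \<Sigma> T)) (leb S) (\<lambda>x. restrict x S)) A
          = (\<integral>\<^sup>+ x. gauss_dens \<mu> \<Sigma> T x * indicator A (restrict x S) \<partial>leb T)"
        by (subst emeasure_distr)
           (auto simp: emeasure_density A' intro!: nn_integral_cong split: split_indicator)
      also have "\<dots> = (\<integral>\<^sup>+ x. (\<integral>\<^sup>+ t. gauss_dens \<mu> \<Sigma> T (x(i := t)) * indicator A (restrict (x(i :=
          t)) S) \<partial>lborel) \<partial>leb S)"
      proof -
        have "(\<lambda>x. ennreal (gauss_dens \<mu> \<Sigma> T x * indicator A (restrict x S))) \<in> borel_measurable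
            (leb T)"
          by measurable
        then show ?thesis
          unfolding T by (intro lborel.product_nn_integral_insert[OF _ i]) auto
      qed
      also have "\<dots> = (\<integral>\<^sup>+ x. gauss_dens \<mu> \<Sigma> S x * indicator A x \<partial>leb S)"
      proof (rule nn_integral_cong)
        fix x assume x: "x \<in> space (leb S)"
        have "restrict (x(i := t)) S = restrict x S" for t
          using i by (auto simp: restrict_def)
        then have "restrict (x(i := t)) S = x" for t
          using restrict_space_leb[OF x] by simp
        then show "(\<integral>\<^sup>+ t. gauss_dens \<mu> \<Sigma> T (x(i := t)) * indicator A (restrict (x(i := t)) S)
            \<partial>lborel)
            = gauss_dens \<mu> \<Sigma> S x * indicator A x"
          using nn_integral_gauss_dens_insert[OF i, of x]
          by (auto simp: T split: split_indicator)
      qed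
      also have "\<dots> = emeasure (density (leb S) (gauss_dens \<mu> \<Sigma> S)) A"
        by (auto simp: emeasure_density intro!: nn_integral_cong split: split_indicator)
      finally show "emeasure (distr (density (leb T) (gauss_dens \<mu> \<Sigma> T)) (leb S) (\<lambda>x. restrict x S))
          A
        = emeasure (density (leb S) (gauss_dens \<mu> \<Sigma> S)) A" .
    qed simp
    finally show ?case by (simp add: S_def)
  qed
  from this[of "- S"] show ?thesis by simp
qed

text \<open>A marginal has the total mass of the law, and the marginal on no variables has density 1
  on a one-point space.\<close>

lemma prob_space_gaussian: "prob_space (gaussian \<mu> \<Sigma>)"
proof
  have m: "(\<lambda>x. restrict x {}) \<in> measurable (gaussian \<mu> \<Sigma>) (leb {})"
    using measurable_restrict_leb[of "{}" UNIV] by (simp add: gaussian_density)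
  have "emeasure (marginal (gaussian \<mu> \<Sigma>) {}) (space (leb {})) = emeasure (gaussian \<mu> \<Sigma>) ((\<lambda>x.
      restrict x {}) -` space (leb {}) \<inter> space (gaussian \<mu> \<Sigma>))"
    unfolding marginal_def by (rule emeasure_distr[OF m sets.top])
  also have "(\<lambda>x. restrict x {}) -` space (leb {}) \<inter> space (gaussian \<mu> \<Sigma>) = space (gaussian \<mu> \<Sigma>)"
    using measurable_space[OF m] by blast
  finally have "emeasure (gaussian \<mu> \<Sigma>) (space (gaussian \<mu> \<Sigma>)) = emeasure (marginal (gaussian \<mu> \<Sigma>)
      {}) (space (leb {}))" ..
  also have "\<dots> = 1"
    by (simp add: marginal_gaussian emeasure_density gauss_dens_empty PiM_empty)
  finally show "emeasure (gaussian \<mu> \<Sigma>) (space (gaussian \<mu> \<Sigma>)) = 1" .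
qed

lemma gaussian_in_distributions: "(gaussian \<mu> \<Sigma>) \<in> distributions"
  using prob_space_gaussian measurable_gauss_dens[of UNIV UNIV \<mu> \<Sigma>]
  by (auto simp: distributions_def gaussian_density)

lemma AE_gaussian: "(AE x in (gaussian \<mu> \<Sigma>). Q x) \<longleftrightarrow> (AE x in leb UNIV. Q x)"
proof -
  note [measurable] = measurable_gauss_dens[of UNIV UNIV \<mu> \<Sigma>]
  show ?thesis
    unfolding gaussian_density by (subst AE_density) (simp_all add: gauss_dens_pos)
qed

end

section \<open>Marginal densities\<close>

lemma positive_definite_mat_1: "positive_definite (mat 1 :: real^'v::finite^'v)"
  by (simp add: positive_definite_def)

text \<open>
  A nondegenerate Gaussian has the null sets of Lebesgue measure, and so do its marginals; hence
  null sets of the marginal space lift to cylinders without a decomposition of the product measure.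
\<close>

lemma AE_leb_restrict:
  assumes "{x \<in> space (leb S). Q x} \<in> sets (leb S)"
  shows "(AE x in leb S. Q x) \<longleftrightarrow> (AE x in leb (UNIV :: 'v::finite set). Q (restrict x S))"
proof -
  let ?P = "gaussian 0 (mat 1) :: ('v \<Rightarrow> real) measure"
  note pd = positive_definite_mat_1
  note [measurable] = measurable_gauss_dens[of S S 0 "mat 1"]
  have "(AE x in leb S. Q x) \<longleftrightarrow> (AE x in marginal ?P S. Q x)"
    unfolding marginal_gaussian[OF pd] by (subst AE_density) (simp_all add: gauss_dens_pos[OF pd])
  also have "\<dots> \<longleftrightarrow> (AE x in ?P. Q (restrict x S))"
    unfolding marginal_def using assms measurable_restrict_leb[of S UNIV]
    by (intro AE_distr_iff) (auto simp: gaussian_density)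
  finally show ?thesis
    by (simp only: AE_gaussian[OF pd])
qed

section \<open>Marginal densities of an arbitrary distribution\<close>

lemma distributionsD:
  assumes "Q \<in> distributions"
  shows "prob_space Q" "sets Q = sets (leb UNIV)" "space Q = UNIV"
    "absolutely_continuous (leb UNIV) Q"
  using assms by (auto simp: distributions_def space_PiM intro: absolutely_continuousI_density)

lemma measurable_restrict_distribution:
  assumes "Q \<in> distributions" shows "(\<lambda>x. restrict x S) \<in> measurable Q (leb S)"
  using measurable_restrict_leb[of S UNIV] measurable_cong_sets[OF distributionsD(2)[OF assms] refl]
  by blast

lemma prob_space_marginal: "Q \<in> distributions \<Longrightarrow> prob_space (marginal Q S)"
  unfolding marginal_def
  by (rule prob_space.prob_space_distr[OF distributionsD(1) measurable_restrict_distribution])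

lemma absolutely_continuous_marginal:
  assumes Q: "Q \<in> distributions" shows "absolutely_continuous (leb S) (marginal Q S)"
  unfolding absolutely_continuous_def
proof
  fix N assume N: "N \<in> null_sets (leb S)"
  then have sN: "N \<in> sets (leb S)" by auto
  have "AE x in leb S. x \<notin> N"
    using N by (rule AE_not_in)
  then have "AE x in leb UNIV. restrict x S \<notin> N"
    by (subst (asm) AE_leb_restrict) (use sN in auto)
  then have "AE x in Q. restrict x S \<notin> N"
    using absolutely_continuous_AE[OF distributionsD(2)[OF Q] distributionsD(4)[OF Q]] by simp
  then have "AE x in marginal Q S. x \<notin> N"
    unfolding marginal_def
    by (subst AE_distr_iff[OF measurable_restrict_distribution[OF Q]]) (use sN in auto)
  then show "N \<in> null_sets (marginal Q S)"
    using sN by (subst (asm) AE_iff_null_sets[symmetric]) (auto simp: marginal_def)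
qed

lemma measurable_mdens:
  assumes "S \<subseteq> T" shows "mdens Q S \<in> borel_measurable (leb T)"
proof -
  note [measurable] = measurable_restrict_leb[OF assms]
  show ?thesis
    unfolding mdens_def by measurable
qed

lemma mdens_restrict [simp]: "mdens Q S (restrict x S) = mdens Q S x"
  by (simp add: mdens_def)

lemma mdens_nonneg [simp]: "0 \<le> mdens Q S x"
  by (simp add: mdens_def)

lemma marginal_density:
  assumes Q: "Q \<in> distributions"
  shows "marginal Q S = density (leb S) (mdens Q S)"
proof -
  note [measurable] = measurable_mdens[of S S]
  interpret leb: sigma_finite_measure "leb S :: ('a \<Rightarrow> real) measure"
    by (rule lborel.sigma_finite) simp
  interpret M: prob_space "marginal Q S"
    by (rule prob_space_marginal[OF Q])
  have s: "sets (marginal Q S) = sets (leb S)"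
    by (simp add: marginal_def)
  note ac = absolutely_continuous_marginal[OF Q, of S]
  have "AE x in leb S. RN_deriv (leb S) (marginal Q S) x \<noteq> \<infinity>"
    by (rule leb.RN_deriv_finite[OF _ ac s]) unfold_locales
  then have "AE x in leb S. RN_deriv (leb S) (marginal Q S) x = ennreal (mdens Q S x)"
  proof (rule AE_mp, intro AE_I2 impI)
    fix x :: "'a \<Rightarrow> real"
    assume "x \<in> space (leb S)" "RN_deriv (leb S) (marginal Q S) x \<noteq> \<infinity>"
    then show "RN_deriv (leb S) (marginal Q S) x = ennreal (mdens Q S x)"
      by (simp add: mdens_def restrict_space_leb less_top)
  qed
  then show ?thesis
    by (subst leb.density_RN_deriv[OF ac s, symmetric]) (intro density_cong, auto)
qed

lemma distribution_density:
  assumes Q: "Q \<in> distributions" shows "Q = density (leb UNIV) (mdens Q UNIV)"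
proof -
  have "marginal Q UNIV = distr Q Q (\<lambda>x. x)"
    unfolding marginal_def by (rule distr_cong) (auto simp: distributionsD[OF Q])
  then show ?thesis
    using marginal_density[OF Q, of UNIV] by simp
qed

text \<open>Radon-Nikodym derivatives are unique almost everywhere on the space of \<open>S\<close>;
  \<open>AE_leb_restrict\<close> lifts this to full outcomes.\<close>

lemma mdens_eqI:
  assumes "marginal Q S = density (leb S) f" "prob_space (marginal Q S)"
    and f: "f \<in> borel_measurable (leb S)" "\<And>x. 0 \<le> f x" "\<And>x. f (restrict x S) = f x"
  shows "AE x in leb UNIV. mdens Q S x = f x"
proof -
  interpret M: prob_space "marginal Q S" by fact
  note [measurable] = f(1)
  have "AE x in leb S. ennreal (f x) = RN_deriv (leb S) (marginal Q S) x"
    by (rule RN_deriv_unique_sigma_finite) (auto simp: assms(1)[symmetric] intro: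
        M.sigma_finite_measure_axioms)
  then have "AE x in leb UNIV. ennreal (f (restrict x S)) = RN_deriv (leb S) (marginal Q S)
      (restrict x S)"
    by (subst (asm) AE_leb_restrict) auto
  then show ?thesis
    by (rule AE_mp) (auto intro!: AE_I2 simp: mdens_def f dest!: sym[of "ennreal _"])
qed

lemma nn_integral_marginal:
  assumes Q: "Q \<in> distributions" and [measurable]: "h \<in> borel_measurable (leb S)"
  shows "(\<integral>\<^sup>+ x. h (restrict x S) \<partial>Q) = (\<integral>\<^sup>+ x. h x * mdens Q S x \<partial>leb S)"
proof -
  note [measurable] = measurable_mdens[of S S]
  have "(\<integral>\<^sup>+ x. h (restrict x S) \<partial>Q) = (\<integral>\<^sup>+ x. h x \<partial>marginal Q S)"
    unfolding marginal_def by (rule nn_integral_distr[symmetric, OF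
        measurable_restrict_distribution[OF Q]]) simp
  then show ?thesis
    by (simp add: marginal_density[OF Q] nn_integral_density mult.commute)
qed

text \<open>A marginal density is positive almost surely under its own law; positivity of the joint
  density turns this into a Lebesgue statement.\<close>

lemma mdens_pos:
  assumes Q: "Q \<in> distributions" and pos: "AE x in leb UNIV. 0 < mdens Q UNIV x"
  shows "AE x in leb UNIV. 0 < mdens Q S x"
proof -
  note [measurable] = measurable_mdens[of S S] measurable_mdens[of UNIV UNIV]
  have "AE x in marginal Q S. 0 < mdens Q S x"
    unfolding marginal_density[OF Q] by (subst AE_density) auto
  then have "AE x in Q. 0 < mdens Q S x"
    unfolding marginal_def by (subst (asm) AE_distr_iff[OF measurable_restrict_distribution[OF Q]])
        auto
  then have "AE x in leb UNIV. 0 < mdens Q UNIV x \<longrightarrow> 0 < mdens Q S x"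
    by (subst (asm) distribution_density[OF Q]) (simp add: AE_density)
  with pos show ?thesis by auto
qed

text \<open>The outcome space of no variables is a single point of mass 1, so the value is forced
  everywhere. Conditioning on \<open>{}\<close> is then no conditioning.\<close>

lemma mdens_empty:
  assumes Q: "Q \<in> distributions" shows "mdens Q {} x = 1"
proof -
  note [measurable] = measurable_mdens[of "{}" "{}"]
  have "1 = emeasure (marginal Q {}) (space (marginal Q {}))"
    using prob_space.emeasure_space_1[OF prob_space_marginal[OF Q]] by simp
  also have "\<dots> = (\<integral>\<^sup>+ x. mdens Q {} x \<partial>leb {})"
    by (simp add: marginal_density[OF Q] emeasure_density cong: nn_integral_cong)
  also have "\<dots> = ennreal (mdens Q {} (\<lambda>_. undefined))"
    by (subst lborel.nn_integral_empty) auto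
  also have "mdens Q {} (\<lambda>_. undefined) = mdens Q {} x"
    by (simp add: mdens_def restrict_def)
  finally show ?thesis
    by simp
qed

text \<open>Integrating against \<open>P\<close> cancels p(T) and leaves p(S)/q(S) under the law of
  \<open>T\<close> in \<open>Q\<close>. Since this depends only on \<open>S\<close>, it reduces to
  the integral of p(S).\<close>

lemma nn_integral_cond_density_ratio:
  assumes P: "P \<in> distributions" "AE x in leb UNIV. 0 < mdens P UNIV x"
    and Q: "Q \<in> distributions" "AE x in leb UNIV. 0 < mdens Q UNIV x" and ST: "S \<subseteq> T"
  shows "(\<integral>\<^sup>+ x. (mdens Q T x / mdens Q S x) / (mdens P T x / mdens P S x) \<partial>P) = 1"
proof -
  note [measurable] = measurable_mdens[OF ST] measurable_mdens[of S S] measurable_mdens[of T T]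
  let ?r = "\<lambda>x. (mdens Q T x / mdens Q S x) / (mdens P T x / mdens P S x)"
  have rS: "mdens R S (restrict x T) = mdens R S x" for R x
    using ST by (simp add: mdens_def Int_absorb1 del: mdens_restrict)
  have T: "AE x in leb T. 0 < mdens R T x"
    if "R \<in> distributions" "AE x in leb UNIV. 0 < mdens R UNIV x" for R
    by (subst AE_leb_restrict) (use mdens_pos[OF that] in auto)
  have S: "AE x in leb S. 0 < mdens R S x"
    if "R \<in> distributions" "AE x in leb UNIV. 0 < mdens R UNIV x" for R
    by (subst AE_leb_restrict) (use mdens_pos[OF that] in auto)
  have "(\<integral>\<^sup>+ x. ?r x \<partial>P) = (\<integral>\<^sup>+ x. ennreal (?r (restrict x T)) \<partial>P)"
    by (simp add: rS)
  also have "\<dots> = (\<integral>\<^sup>+ x. ennreal (?r x) * mdens P T x \<partial>leb T)"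
    by (rule nn_integral_marginal[OF P(1)]) measurable
  also have "\<dots> = (\<integral>\<^sup>+ x. ennreal (mdens P S x / mdens Q S x) * mdens Q T x \<partial>leb T)"
    by (rule nn_integral_cong_AE, use T[OF P] in eventually_elim)
       (simp add: field_simps flip: ennreal_mult)
  \<comment> \<open>Returning to the full law \<open>Q\<close> and then descending to
    \<open>S\<close> replaces integrating out the variables in \<open>T - S\<close>.\<close>
  also have "\<dots> = (\<integral>\<^sup>+ x. ennreal (mdens P S (restrict x T) / mdens Q S (restrict x T)) \<partial>Q)"
    by (rule nn_integral_marginal[OF Q(1), symmetric]) measurable
  also have "\<dots> = (\<integral>\<^sup>+ x. ennreal (mdens P S (restrict x S) / mdens Q S (restrict x S)) \<partial>Q)"
    by (simp add: rS)
  also have "\<dots> = (\<integral>\<^sup>+ x. ennreal (mdens P S x / mdens Q S x) * mdens Q S x \<partial>leb S)"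
    by (rule nn_integral_marginal[OF Q(1)]) measurable
  also have "\<dots> = (\<integral>\<^sup>+ x. ennreal (mdens P S x) \<partial>leb S)"
    by (rule nn_integral_cong_AE, use S[OF Q] in eventually_elim) (simp flip: ennreal_mult)
  also have "\<dots> = emeasure (marginal P S) (space (marginal P S))"
    by (simp add: marginal_density[OF P(1)] emeasure_density cong: nn_integral_cong)
  also have "\<dots> = 1"
    by (rule prob_space.emeasure_space_1[OF prob_space_marginal[OF P(1)]])
  finally show ?thesis .
qed

lemma mdens_gaussian:
  assumes "positive_definite \<Sigma>"
  shows "AE x in leb UNIV. mdens (gaussian \<mu> \<Sigma>) S x = gauss_dens \<mu> \<Sigma> S x"
  using prob_space_marginal[OF gaussian_in_distributions[OF assms]]
  by (intro mdens_eqI marginal_gaussian assms)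
     (auto simp: measurable_gauss_dens less_imp_le[OF gauss_dens_pos[OF assms]])

section \<open>Second moments and conditional mutual information\<close>

lemma cond_cov_cong: "S \<subseteq> Z \<Longrightarrow> S \<subseteq> Z' \<Longrightarrow> sub_det S (cond_cov Z C M) = sub_det S (cond_cov Z' C M)"
proof (rule sub_det_cong)
  assume S: "S \<subseteq> Z" "S \<subseteq> Z'"
  have "sub S S (cond_cov W C M)
      = sub S S M - sub S C M ** sub_inv C M ** sub C S M" if "S \<subseteq> W" for W
  proof -
    have "S \<inter> W = S" "W \<inter> S = S" using that by auto
    then show ?thesis
      by (simp add: cond_cov_def sub_eq matrix_ring coord_mult coord_mult')
  qed
  with S show "sub S S (cond_cov Z C M) = sub S S (cond_cov Z' C M)"
    by simp
qed

text \<open>Only the logarithm of the product is known to be integrable. So the three terms r - 1 -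
  ln r are summed into one nonnegative function \<open>f\<close>, whose integral is minus that of
  the logarithm; it must vanish, and with it each term.\<close>

lemma ln_product_expectation_nonneg:
  fixes r1 r2 r3 :: "'a \<Rightarrow> real"
  assumes M: "prob_space M"
    and r [measurable]: "r1 \<in> borel_measurable M" "r2 \<in> borel_measurable M" "r3 \<in> borel_measurable
        M"
    and pos: "AE x in M. 0 < r1 x \<and> 0 < r2 x \<and> 0 < r3 x"
    and expect: "(\<integral>\<^sup>+ x. r1 x \<partial>M) = 1" "(\<integral>\<^sup>+ x. r2 x \<partial>M) = 1" "(\<integral>\<^sup>+ x. r3 x \<partial>M) = 1"
    and ln: "integrable M (\<lambda>x. ln (r1 x * r2 x * r3 x))" "0 \<le> (\<integral>x. ln (r1 x * r2 x * r3 x) \<partial>M)"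
  shows "AE x in M. r1 x = 1 \<and> r2 x = 1 \<and> r3 x = 1"
proof -
  interpret prob_space M by fact
  have E: "has_bochner_integral M r 1"
    if "(\<integral>\<^sup>+ x. r x \<partial>M) = 1" "AE x in M. 0 < r x" "r \<in> borel_measurable M" for r
    using that by (intro has_bochner_integral_nn_integral) auto
  have E1: "has_bochner_integral M r1 1" and E2: "has_bochner_integral M r2 1"
    and E3: "has_bochner_integral M r3 1"
    using pos by (auto intro!: E expect elim: AE_mp)
  note int = E1[THEN integrable.intros] E2[THEN integrable.intros] E3[THEN integrable.intros]
  define f where "f x = (r1 x - 1) + (r2 x - 1) + (r3 x - 1) - ln (r1 x * r2 x * r3 x)" for x
  have f: "integrable M f"
    unfolding f_def using int ln(1) by simp
  have f_sum: "AE x in M. f x = (r1 x - 1 - ln (r1 x)) + (r2 x - 1 - ln (r2 x)) + (r3 x - 1 - ln (r3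
      x))"
    using pos by eventually_elim (simp add: f_def ln_mult)
  have le: "0 \<le> t - 1 - ln t" if "0 < t" for t :: real
    using ln_le_minus_one[OF that] by simp
  have f_nonneg: "AE x in M. 0 \<le> f x"
    using f_sum pos
  proof eventually_elim
    case (elim x)
    then show ?case
      using le[of "r1 x"] le[of "r2 x"] le[of "r3 x"] by linarith
  qed
  have "(\<integral>x. f x \<partial>M) = - (\<integral>x. ln (r1 x * r2 x * r3 x) \<partial>M)"
    unfolding f_def using int ln(1) E1 E2 E3
    by (simp add: has_bochner_integral_integral_eq prob_space)
  also have "\<dots> \<le> 0"
    using ln(2) by simp
  finally have "(\<integral>x. f x \<partial>M) = 0"
    using integral_nonneg_AE[OF f_nonneg] by simp
  then have "AE x in M. f x = 0"
    using integral_nonneg_eq_0_iff_AE[OF f f_nonneg] by simp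
  with f_sum pos show ?thesis
  proof eventually_elim
    case (elim x)
    then have "r1 x - 1 - ln (r1 x) = 0" "r2 x - 1 - ln (r2 x) = 0" "r3 x - 1 - ln (r3 x) = 0"
      using le[of "r1 x"] le[of "r2 x"] le[of "r3 x"] by linarith+
    then show ?case
      using elim ln_eq_minus_one by force
  qed
qed

lemma mult_interchange:
  fixes a :: "'a::comm_semiring_1"
  shows "a * c = a' * c' \<Longrightarrow> b * d = b' * d' \<Longrightarrow> (a * b) * (c * d) = (a' * b') * (c' * d')"
  by (metis mult.assoc mult.left_commute)

lemma AE_distribution:
  assumes Q: "Q \<in> distributions" and pos: "AE x in leb UNIV. 0 < mdens Q UNIV x"
  shows "(AE x in Q. R x) \<longleftrightarrow> (AE x in leb UNIV. R x)"
proof -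
  note [measurable] = measurable_mdens[of UNIV UNIV Q]
  have "(AE x in Q. R x) \<longleftrightarrow> (AE x in leb UNIV. 0 < mdens Q UNIV x \<longrightarrow> R x)"
    by (subst distribution_density[OF Q], subst AE_density) auto
  also have "\<dots> \<longleftrightarrow> (AE x in leb UNIV. R x)"
    using pos by (auto elim: AE_mp)
  finally show ?thesis .
qed

text \<open>Positivity of q makes \<open>P\<close> absolutely continuous with respect to
  \<open>Q\<close> with derivative p/q, so the entropy density is the log-ratio almost
  everywhere.\<close>

lemma KL_mdens:
  assumes P: "P \<in> distributions" "AE x in leb UNIV. 0 < mdens P UNIV x"
    and Q: "Q \<in> distributions" "AE x in leb UNIV. 0 < mdens Q UNIV x"
  defines "r x \<equiv> ln (mdens P UNIV x / mdens Q UNIV x)"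
  shows "KL P Q = (if integrable P r then ereal (\<integral>x. r x \<partial>P) else \<infinity>)"
proof -
  note [measurable] = measurable_mdens[of UNIV UNIV P] measurable_mdens[of UNIV UNIV Q]
  have sets: "sets P = sets (leb UNIV)" "sets Q = sets (leb UNIV)"
    using P Q distributionsD(2) by auto
  let ?f = "\<lambda>x. mdens P UNIV x / mdens Q UNIV x"
  have f: "(\<lambda>x. ennreal (?f x)) \<in> borel_measurable Q"
    by (subst measurable_cong_sets[OF sets(2) refl]) measurable
  have "density Q ?f = density (leb UNIV) (\<lambda>x. ennreal (mdens Q UNIV x) * ennreal (?f x))"
    by (subst distribution_density[OF Q(1)], rule density_density_eq) auto
  also have "\<dots> = density (leb UNIV) (mdens P UNIV)"
    by (rule density_cong, simp, simp, use Q(2) in eventually_elim) (simp flip: ennreal_mult)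
  also have "\<dots> = P"
    by (rule distribution_density[OF P(1), symmetric])
  finally have PQ: "density Q ?f = P" .
  have "absolutely_continuous Q P"
    using absolutely_continuousI_density[OF f] by (simp only: PQ)
  interpret P: prob_space P
    by (rule distributionsD(1)[OF P(1)])
  have "AE x in Q. ennreal (?f x) = RN_deriv Q P x"
    by (rule RN_deriv_unique_sigma_finite[OF f PQ]) unfold_locales
  then have "AE x in P. ennreal (?f x) = RN_deriv Q P x"
    by (simp only: AE_distribution[OF P] AE_distribution[OF Q])
  then have ed: "AE x in P. entropy_density (exp 1) Q P x = r x"
  proof eventually_elim
    case (elim x)
    have "enn2real (RN_deriv Q P x) = ?f x"
      by (simp flip: elim)
    then show ?case
      by (simp add: entropy_density_def r_def log_def)
  qed
  have m: "entropy_density (exp 1) Q P \<in> borel_measurable P" "r \<in> borel_measurable P"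
    using measurable_entropy_density[of "exp 1" Q P]
    by (auto simp: r_def[abs_def] measurable_cong_sets[OF sets(1) refl] measurable_cong_sets[OF
        sets(2) refl])
  show ?thesis
    using \<open>absolutely_continuous Q P\<close> integrable_cong_AE[OF m ed] integral_cong_AE[OF m ed]
    by (simp add: KL_def KL_divergence_def)
qed

section \<open>Moments, entropy and conditional mutual information of a Gaussian\<close>

context
  fixes \<mu> :: "real^'v::finite" and \<Sigma> :: "real^'v^'v"
  assumes pd: "positive_definite \<Sigma>"
begin

private abbreviation (input) "g \<equiv> gauss_dens \<mu> \<Sigma>"
private abbreviation (input) "P \<equiv> gaussian \<mu> \<Sigma>"

lemma measurable_restrict_gaussian: "(\<lambda>x. restrict x S) \<in> measurable P (leb S)"
  by (rule measurable_restrict_distribution[OF gaussian_in_distributions[OF pd]])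

lemma measurable_component_gaussian [measurable]: "(\<lambda>x. x i) \<in> borel_measurable P"
  using measurable_component_singleton[of i UNIV "\<lambda>_. lborel"] by (simp add: gaussian_density)

lemma cov_symmetric: "\<Sigma> $ i $ j = \<Sigma> $ j $ i"
  using arg_cong[OF positive_definite_transpose[OF pd], of "\<lambda>M. M $ j $ i"] by (simp add:
      transpose_def)

lemma cov_diagonal_pos: "0 < \<Sigma> $ i $ i"
  using sub_det_pos[OF pd, of "{i}"] by (simp add: sub_det_singleton)

text \<open>An off-diagonal entry of inverse times block; it evaluates the regression coefficient of
  \<open>i\<close> on \<open>j\<close> in \<open>gaussian_covariance\<close>.\<close>

lemma sub_inv_pair:
  assumes "i \<noteq> j"
  shows "sub_inv {i, j} \<Sigma> $ i $ i * \<Sigma> $ i $ j + sub_inv {i, j} \<Sigma> $ j $ i * \<Sigma> $ j $ j = 0"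
proof -
  have "(sub_inv {i, j} \<Sigma> ** (\<Sigma> ** coord {j})) $ i $ j = 0"
    using assms by (subst sub_inv_cov_coord[OF pd]) (auto simp: coord_def)
  moreover have "(sub_inv {i, j} \<Sigma> ** (\<Sigma> ** coord {j})) $ i $ j = (\<Sum>k\<in>UNIV. sub_inv {i, j} \<Sigma> $ i $ k
      * \<Sigma> $ k $ j)"
    by (simp add: matrix_mul_assoc mult_coord_nth) (simp add: matrix_matrix_mult_def)
  moreover have "\<dots> = (\<Sum>k\<in>{i, j}. sub_inv {i, j} \<Sigma> $ i $ k * \<Sigma> $ k $ j)"
    by (rule sum.mono_neutral_right) (auto simp: sub_inv_def sub_def)
  ultimately show ?thesis
    using assms sub_inv_symmetric[OF pd, of "{i, j}" i j] by simp
qed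

lemma distr_gaussian_component:
  "distr P lborel (\<lambda>x. x i) = density lborel (normal_density (\<mu> $ i) (sqrt (\<Sigma> $ i $ i)))"
proof -
  have K: "1 / sub_inv {i} \<Sigma> $ i $ i = \<Sigma> $ i $ i"
    using sub_det_insert[OF pd, of i "{}"] sub_inv_diagonal_pos[OF pd, of i "{i}"]
    by (simp add: sub_det_singleton)
  have sqrt: "1 / sqrt (sub_inv {i} \<Sigma> $ i $ i) = sqrt (\<Sigma> $ i $ i)"
    unfolding K[symmetric] by (simp add: real_sqrt_divide)
  have g: "g {i} x = normal_density (\<mu> $ i) (sqrt (\<Sigma> $ i $ i)) (x i)" for x
  proof -
    \<comment> \<open>The vacuous update matches \<open>gauss_dens_insert\<close> with the empty
      set, whose density is 1.\<close>
    have "g {i} x = g {i} (x(i := x i))" by simp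
    also have "\<dots> = normal_density (\<mu> $ i) (sqrt (\<Sigma> $ i $ i)) (x i)"
      by (subst gauss_dens_insert[OF pd, of i "{}", simplified])
         (simp add: gauss_dens_empty[OF pd] cond_mean_def[OF pd] sqrt)
    finally show ?thesis .
  qed
  have [measurable]: "(\<lambda>x. x i) \<in> borel_measurable (leb {i})"
    using measurable_component_singleton[of i "{i}" "\<lambda>_. lborel"] by simp
  have "distr P lborel (\<lambda>x. x i) = distr (marginal P {i}) lborel (\<lambda>x. x i)"
    unfolding marginal_def
    by (subst distr_distr[OF _ measurable_restrict_gaussian]) (auto simp: comp_def)
  also have "\<dots> = distr (density (leb {i}) (\<lambda>x. normal_density (\<mu> $ i) (sqrt (\<Sigma> $ i $ i)) (x i)))
      lborel (\<lambda>x. x i)"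
    by (simp add: marginal_gaussian[OF pd] g)
  also have "\<dots> = density (distr (leb {i}) lborel (\<lambda>x. x i)) (normal_density (\<mu> $ i) (sqrt (\<Sigma> $ i $
      i)))"
    by (subst density_distr) auto
  also have "distr (leb {i}) lborel (\<lambda>x. x i) = lborel"
    by (rule lborel.distr_singleton)
  finally show ?thesis .
qed

lemma gaussian_component_integral:
  fixes f :: "real \<Rightarrow> real"
  assumes [measurable]: "f \<in> borel_measurable borel"
  shows "integrable P (\<lambda>x. f (x i))
      \<longleftrightarrow> integrable lborel (\<lambda>t. normal_density (\<mu> $ i) (sqrt (\<Sigma> $ i $ i)) t * f t)"
    and "(\<integral>x. f (x i) \<partial>P) = (\<integral>t. normal_density (\<mu> $ i) (sqrt (\<Sigma> $ i $ i)) t * f t \<partial>lborel)"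
proof -
  have [measurable]: "(\<lambda>x. x i) \<in> measurable P lborel" by simp
  have "integrable P (\<lambda>x. f (x i)) \<longleftrightarrow> integrable (distr P lborel (\<lambda>x. x i)) f"
    by (rule integrable_distr_eq[symmetric]) auto
  then show "integrable P (\<lambda>x. f (x i))
      \<longleftrightarrow> integrable lborel (\<lambda>t. normal_density (\<mu> $ i) (sqrt (\<Sigma> $ i $ i)) t * f t)"
    unfolding distr_gaussian_component by (subst (asm) integrable_density) auto
  have "(\<integral>x. f (x i) \<partial>P) = integral\<^sup>L (distr P lborel (\<lambda>x. x i)) f"
    by (rule integral_distr[symmetric]) auto
  then show "(\<integral>x. f (x i) \<partial>P) = (\<integral>t. normal_density (\<mu> $ i) (sqrt (\<Sigma> $ i $ i)) t * f t \<partial>lborel)"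
    unfolding distr_gaussian_component by (subst (asm) integral_density) auto
qed

lemma gaussian_mean: "integrable P (\<lambda>x. x i)" "(\<integral>x. x i \<partial>P) = \<mu> $ i"
  using gaussian_component_integral[of "\<lambda>t. t" i] cov_diagonal_pos[of i]
  by (simp_all add: integrable_normal_moment_nz_1 integral_normal_moment_nz_1)

lemma gaussian_variance:
  "integrable P (\<lambda>x. (x i - \<mu> $ i)\<^sup>2)" "(\<integral>x. (x i - \<mu> $ i)\<^sup>2 \<partial>P) = \<Sigma> $ i $ i"
  using gaussian_component_integral[of "\<lambda>t. (t - \<mu> $ i)\<^sup>2" i] cov_diagonal_pos[of i]
    integrable_normal_moment[of "sqrt (\<Sigma> $ i $ i)" "\<mu> $ i" 2]
    integral_normal_moment_even[of "sqrt (\<Sigma> $ i $ i)" "\<mu> $ i" 1]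
  by (simp_all add: fact_numeral)

lemma gaussian_product_integrable: "integrable P (\<lambda>x. (x i - \<mu> $ i) * (x j - \<mu> $ j))"
proof (rule Bochner_Integration.integrable_bound)
  show "integrable P (\<lambda>x. (x i - \<mu> $ i)\<^sup>2 + (x j - \<mu> $ j)\<^sup>2)"
    by (intro Bochner_Integration.integrable_add gaussian_variance)
  have "\<bar>a * b\<bar> \<le> a\<^sup>2 + b\<^sup>2" for a b :: real
  proof -
    have "2 * (\<bar>a\<bar> * \<bar>b\<bar>) \<le> a\<^sup>2 + b\<^sup>2"
      using sum_squares_bound[of "\<bar>a\<bar>" "\<bar>b\<bar>"] by simp
    moreover have "0 \<le> \<bar>a\<bar> * \<bar>b\<bar>"
      by simp
    ultimately show ?thesis
      unfolding abs_mult by linarith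
  qed
  then show "AE x in P. norm ((x i - \<mu> $ i) * (x j - \<mu> $ j)) \<le> norm ((x i - \<mu> $ i)\<^sup>2 + (x j - \<mu> $
      j)\<^sup>2)"
    by (auto intro!: AE_I2)
qed simp

lemma gaussian_integral_restrict:
  fixes f :: "('v \<Rightarrow> real) \<Rightarrow> real"
  assumes [measurable]: "f \<in> borel_measurable (leb S)"
  shows "(\<integral>x. f (restrict x S) \<partial>P) = (\<integral>x. g S x * f x \<partial>leb S)"
    and "integrable P (\<lambda>x. f (restrict x S)) \<longleftrightarrow> integrable (leb S) (\<lambda>x. g S x * f x)"
proof -
  note [measurable] = measurable_gauss_dens[of S S \<mu> \<Sigma>]
  have "(\<integral>x. f (restrict x S) \<partial>P) = integral\<^sup>L (marginal P S) f"
    unfolding marginal_def by (rule integral_distr[symmetric, OF measurable_restrict_gaussian]) simp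
  then show "(\<integral>x. f (restrict x S) \<partial>P) = (\<integral>x. g S x * f x \<partial>leb S)"
    unfolding marginal_gaussian[OF pd]
    by (subst (asm) integral_density) (auto simp: less_imp_le[OF gauss_dens_pos[OF pd]])
  have "integrable P (\<lambda>x. f (restrict x S)) \<longleftrightarrow> integrable (marginal P S) f"
    unfolding marginal_def by (rule integrable_distr_eq[symmetric, OF measurable_restrict_gaussian])
        simp
  then show "integrable P (\<lambda>x. f (restrict x S)) \<longleftrightarrow> integrable (leb S) (\<lambda>x. g S x * f x)"
    unfolding marginal_gaussian[OF pd]
    by (subst (asm) integrable_density) (auto simp: less_imp_le[OF gauss_dens_pos[OF pd]])
qed

text \<open>Off the diagonal, pass to the marginal of the pair and integrate coordinate
  \<open>i\<close> first against its conditional normal law; the variance of \<open>j\<close>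
  remains.\<close>

lemma gaussian_covariance: "(\<integral>x. (x i - \<mu> $ i) * (x j - \<mu> $ j) \<partial>P) = \<Sigma> $ i $ j"
proof (cases "i = j")
  case True
  then show ?thesis
    using gaussian_variance(2)[of i] by (simp add: power2_eq_square)
next
  case False
  define T where "T = {i, j}"
  define k where "k = sub_inv T \<Sigma> $ i $ i"
  define a where "a = sub_inv T \<Sigma> $ j $ i"
  have k: "0 < k"
    unfolding k_def by (rule sub_inv_diagonal_pos[OF pd]) (simp add: T_def)
  define f where "f x = (x i - \<mu> $ i) * (x j - \<mu> $ j)" for x :: "'v \<Rightarrow> real"
  have m: "(\<lambda>x. x l) \<in> borel_measurable (leb T)" if "l \<in> T" for l T
    using measurable_component_singleton[of l T "\<lambda>_. lborel"] that by simp
  have [measurable]: "f \<in> borel_measurable (leb T)"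
    unfolding f_def using m[of i T] m[of j T] by (simp add: T_def)
  have fT: "f (restrict x T) = f x" for x
    by (simp add: f_def T_def)
  have int: "integrable (leb T) (\<lambda>x. g T x * f x)"
    using gaussian_integral_restrict(2)[of f T] gaussian_product_integrable[of i j, folded f_def]
    by (simp only: fT) simp
  have "(\<integral>x. f x \<partial>P) = (\<integral>x. g T x * f x \<partial>leb T)"
    using gaussian_integral_restrict(1)[of f T] by (simp add: fT)
  also have "\<dots> = (\<integral>x. (\<integral>t. g T (x(i := t)) * f (x(i := t)) \<partial>lborel) \<partial>leb {j})"
    unfolding T_def by (rule lborel.product_integral_insert) (use False int in \<open>auto simp: T_def\<close>)
  \<comment> \<open>The conditional mean of the centered coordinate \<open>i\<close> is
    \<open>- a / k\<close> times the centered coordinate \<open>j\<close>.\<close>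
  also have "\<dots> = (\<integral>x. g {j} x * (- a / k * (x j - \<mu> $ j)\<^sup>2) \<partial>leb {j})"
  proof (rule Bochner_Integration.integral_cong[OF refl])
    fix x :: "'v \<Rightarrow> real"
    let ?m = "cond_mean \<mu> \<Sigma> i {j} x"
    have m: "?m - \<mu> $ i = - a / k * (x j - \<mu> $ j)"
      by (simp add: cond_mean_def[OF pd] a_def k_def T_def)
    let ?n = "normal_density ?m (1 / sqrt k)"
    have "(\<integral>t. g T (x(i := t)) * f (x(i := t)) \<partial>lborel)
        = (\<integral>t. (g {j} x * (x j - \<mu> $ j)) * (?n t * t - \<mu> $ i * ?n t) \<partial>lborel)"
    proof (rule Bochner_Integration.integral_cong[OF refl])
      fix t
      have "g T (x(i := t)) = g {j} x * ?n t"
        unfolding T_def k_def by (rule gauss_dens_insert[OF pd]) (use False in auto)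
      then show "g T (x(i := t)) * f (x(i := t)) = (g {j} x * (x j - \<mu> $ j)) * (?n t * t - \<mu> $ i *
          ?n t)"
        using False by (simp add: f_def algebra_simps)
    qed
    also have "\<dots> = (g {j} x * (x j - \<mu> $ j)) * (?m - \<mu> $ i)"
      using k by (simp add: integral_normal_moment_nz_1 integrable_normal_moment_nz_1)
    finally show "(\<integral>t. g T (x(i := t)) * f (x(i := t)) \<partial>lborel)
        = g {j} x * (- a / k * (x j - \<mu> $ j)\<^sup>2)"
      unfolding m by (simp add: power2_eq_square)
  qed
  also have "\<dots> = (\<integral>x. - a / k * (x j - \<mu> $ j)\<^sup>2 \<partial>P)"
    using gaussian_integral_restrict(1)[of "\<lambda>x. - a / k * (x j - \<mu> $ j)\<^sup>2" "{j}"] m[of j "{j}"]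
    by auto
  also have "\<dots> = - a / k * \<Sigma> $ j $ j"
    by (simp only: integral_mult_right_zero gaussian_variance)
  also have "\<dots> = \<Sigma> $ i $ j"
    using sub_inv_pair[OF False] k by (simp add: k_def a_def T_def field_simps)
  finally show ?thesis
    by (simp add: f_def)
qed

lemma covariance_matrix_gaussian: "covariance_matrix P = \<Sigma>"
  by (simp add: covariance_matrix_def gaussian_mean gaussian_covariance vec_eq_iff)

text \<open>The expected form is the trace of the block inverse times the block, hence the trace of
  the identity on \<open>S\<close>.\<close>

lemma gaussian_expect_exponent:
  defines "q S x \<equiv> ((\<chi> i. x i) - \<mu>) \<bullet> (sub_inv S \<Sigma> *v ((\<chi> i. x i) - \<mu>))"
  shows "integrable P (q S)" "(\<integral>x. q S x \<partial>P) = card S"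
proof -
  have q: "q S = (\<lambda>x. \<Sum>i\<in>S. \<Sum>j\<in>S. sub_inv S \<Sigma> $ i $ j * ((x i - \<mu> $ i) * (x j - \<mu> $ j)))"
    unfolding q_def gauss_dens_exponent ..
  show "integrable P (q S)"
    unfolding q by (intro Bochner_Integration.integrable_sum integrable_mult_right
        gaussian_product_integrable)
  have "(\<integral>x. q S x \<partial>P) = (\<Sum>i\<in>S. \<Sum>j\<in>S. sub_inv S \<Sigma> $ i $ j * \<Sigma> $ i $ j)"
    unfolding q by (simp add: gaussian_product_integrable gaussian_covariance)
  also have "\<dots> = (\<Sum>i\<in>S. 1)"
  proof (rule sum.cong[OF refl])
    fix i assume i: "i \<in> S"
    have "(\<Sum>j\<in>S. sub_inv S \<Sigma> $ i $ j * \<Sigma> $ i $ j) = (\<Sum>j\<in>UNIV. sub_inv S \<Sigma> $ i $ j * \<Sigma> $ j $ i)"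
      by (rule sum.mono_neutral_cong_left) (auto simp: sub_inv_def sub_def cov_symmetric)
    also have "\<dots> = (sub_inv S \<Sigma> ** (\<Sigma> ** coord S)) $ i $ i"
      using i by (simp add: matrix_mul_assoc mult_coord_nth) (simp add: matrix_matrix_mult_def)
    also have "\<dots> = 1"
      using i by (simp add: sub_inv_cov_coord[OF pd]) (simp add: coord_def)
    finally show "(\<Sum>j\<in>S. sub_inv S \<Sigma> $ i $ j * \<Sigma> $ i $ j) = 1" .
  qed
  finally show "(\<integral>x. q S x \<partial>P) = card S" by simp
qed

lemma gaussian_entropy:
  "integrable P (\<lambda>x. ln (g S x))"
  "(\<integral>x. ln (g S x) \<partial>P) = - (card S + (card S * ln (2 * pi) + ln (sub_det S \<Sigma>))) / 2"
proof -
  interpret prob_space P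
    by (rule prob_space_gaussian[OF pd])
  have ln: "ln (g S x) = - (1/2) * (((\<chi> i. x i) - \<mu>) \<bullet> (sub_inv S \<Sigma> *v ((\<chi> i. x i) - \<mu>)))
      + - (card S * ln (2 * pi) + ln (sub_det S \<Sigma>)) / 2" for x
    using sub_det_pos[OF pd, of S]
    by (simp add: gauss_dens_def ln_div ln_sqrt ln_mult ln_realpow) (simp add: field_simps)
  show "integrable P (\<lambda>x. ln (g S x))"
    unfolding ln using gaussian_expect_exponent(1)[of S] by (intro
        Bochner_Integration.integrable_add integrable_mult_right) auto
  show "(\<integral>x. ln (g S x) \<partial>P) = - (card S + (card S * ln (2 * pi) + ln (sub_det S \<Sigma>))) / 2"
    unfolding ln using gaussian_expect_exponent[of S] prob_space
    by (subst Bochner_Integration.integral_add) (auto simp: field_simps)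
qed

text \<open>By disjointness the cardinality terms of the four entropies cancel, which leaves the
  log-determinants.\<close>

lemma cond_mutual_info_gaussian:
  assumes "A \<inter> B = {}" "A \<inter> C = {}" "B \<inter> C = {}"
  defines "\<Phi> \<equiv> cond_cov (A \<union> B) C \<Sigma>"
  shows "cond_mutual_info P (A, B, C) = 1/2 * ln (sub_det A \<Phi> * sub_det B \<Phi> / sub_det (A \<union> B) \<Phi>)"
proof -
  define d where "d S = sub_det S \<Sigma>" for S
  have d: "0 < d S" for S
    unfolding d_def by (rule sub_det_pos[OF pd])
  \<comment> \<open>Determinants of conditional covariances are quotients of block determinants, so
    the four log-determinants regroup into those of \<Phi>.\<close>
  have \<Phi>: "sub_det S \<Phi> = d (C \<union> S) / d C" if "S \<subseteq> A \<union> B" for S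
  proof -
    have "C \<inter> S = {}" using that assms by auto
    then show ?thesis
      using sub_det_Un[OF pd, of C S] d[of C] cond_cov_cong[of S "A \<union> B" S C \<Sigma>] that
      by (simp add: \<Phi>_def d_def)
  qed
  have dens: "AE x in P. mdens P S x = g S x" for S
    using mdens_gaussian[OF pd] by (simp only: AE_gaussian[OF pd])
  have "cond_mutual_info P (A, B, C)
      = (\<integral>x. ln (g (A \<union> B \<union> C) x) + ln (g C x) - ln (g (A \<union> C) x) - ln (g (B \<union> C) x) \<partial>P)"
  proof -
    have [measurable]: "mdens P S \<in> borel_measurable P" "g S \<in> borel_measurable P" for S
      using measurable_mdens[of S UNIV P] measurable_gauss_dens[of S UNIV \<mu> \<Sigma>] by (simp_all add:
          gaussian_density)
    have pos: "0 < g S x" for S x by (rule gauss_dens_pos[OF pd])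
    show ?thesis
      unfolding cond_mutual_info.simps cdens_def
    proof (rule integral_cong_AE)
      show "AE x in P. ln (mdens P (A \<union> B \<union> C) x / mdens P C x
          / (mdens P (A \<union> C) x / mdens P C x * (mdens P (B \<union> C) x / mdens P C x)))
        = ln (g (A \<union> B \<union> C) x) + ln (g C x) - ln (g (A \<union> C) x) - ln (g (B \<union> C) x)"
        using dens[of "A \<union> B \<union> C"] dens[of C] dens[of "A \<union> C"] dens[of "B \<union> C"]
      proof eventually_elim
        case (elim x)
        then show ?case
          using pos[of "A \<union> B \<union> C" x] pos[of C x] pos[of "A \<union> C" x] pos[of "B \<union> C" x]
          by (simp add: ln_div ln_mult)
      qed
    qed measurable
  qed
  also have "\<dots> = (\<integral>x. ln (g (A \<union> B \<union> C) x) \<partial>P) + (\<integral>x. ln (g C x) \<partial>P)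
      - (\<integral>x. ln (g (A \<union> C) x) \<partial>P) - (\<integral>x. ln (g (B \<union> C) x) \<partial>P)"
    using gaussian_entropy(1) by simp
  also have "\<dots> = 1/2 * (ln (d (A \<union> C)) + ln (d (B \<union> C)) - ln (d (A \<union> B \<union> C)) - ln (d C))"
  proof -
    have "card (A \<union> B \<union> C) = card A + card B + card C" "card (A \<union> C) = card A + card C"
        "card (B \<union> C) = card B + card C"
      using assms by (simp_all add: card_Un_disjoint Int_Un_distrib2)
    then show ?thesis
      unfolding gaussian_entropy(2) d_def by (simp add: field_simps)
  qed
  also have "\<dots> = 1/2 * ln (sub_det A \<Phi> * sub_det B \<Phi> / sub_det (A \<union> B) \<Phi>)"
  proof -
    have "sub_det A \<Phi> = d (A \<union> C) / d C" "sub_det B \<Phi> = d (B \<union> C) / d C"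
      "sub_det (A \<union> B) \<Phi> = d (A \<union> B \<union> C) / d C"
      by (simp_all add: \<Phi> Un_ac)
    then show ?thesis
      using d[of "A \<union> C"] d[of "B \<union> C"] d[of "A \<union> B \<union> C"] d[of C] by (simp add: ln_div ln_mult)
  qed
  finally show ?thesis .
qed

section \<open>The moment projection of a Gaussian\<close>

context
  fixes A B C :: "'v set"
  assumes disjoint: "A \<inter> B = {}" "A \<inter> C = {}" "B \<inter> C = {}"
begin

private abbreviation (input) "Sq \<equiv> proj_cov (A, B, C) \<Sigma>"
private abbreviation (input) "gp \<equiv> gauss_dens \<mu> Sq"
private abbreviation (input) "Pp \<equiv> gaussian \<mu> Sq"

private lemmas pdp = positive_definite_proj_cov[OF pd disjoint]

lemma gauss_dens_proj_block: "S \<subseteq> A \<union> C \<or> S \<subseteq> B \<union> C \<Longrightarrow> gp S x = g S x"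
  using proj_cov_block_same[OF pd disjoint, of S]
  by (simp add: gauss_dens_def sub_inv_cong[of S Sq \<Sigma>] sub_det_cong[of S Sq \<Sigma>])

text \<open>The exponents agree because \<open>N\<close> plus \<open>sub_inv C \<Sigma>\<close> is
  the sum of the other two inverses; the constants agree by the determinant identity and the count
  of variables.\<close>

lemma gauss_dens_proj_Y: "gp (A \<union> B \<union> C) x * g C x = g (A \<union> C) x * g (B \<union> C) x"
proof -
  let ?v = "(\<chi> i. x i) - \<mu>"
  have "card (A \<union> B \<union> C) + card C = card (A \<union> C) + card (B \<union> C)"
    using disjoint by (simp add: card_Un_disjoint Int_Un_distrib2)
  then have "(2 * pi) ^ card (A \<union> B \<union> C) * (2 * pi) ^ card C = (2 * pi) ^ card (A \<union> C) * (2 * pi) ^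
      card (B \<union> C)"
    by (simp only: flip: power_add)
  moreover note sub_det_proj_cov(1)[OF pd disjoint]
  ultimately have s: "sqrt ((2 * pi) ^ card (A \<union> B \<union> C) * sub_det (A \<union> B \<union> C) Sq) * sqrt ((2 * pi) ^
      card C * sub_det C \<Sigma>)
      = sqrt ((2 * pi) ^ card (A \<union> C) * sub_det (A \<union> C) \<Sigma>)
        * sqrt ((2 * pi) ^ card (B \<union> C) * sub_det (B \<union> C) \<Sigma>)"
    unfolding real_sqrt_mult[symmetric] by (intro arg_cong[where f = sqrt] mult_interchange)
  have "?v \<bullet> (sub_inv (A \<union> B \<union> C) Sq *v ?v) + ?v \<bullet> (sub_inv C \<Sigma> *v ?v)
      = ?v \<bullet> (sub_inv (A \<union> C) \<Sigma> *v ?v) + ?v \<bullet> (sub_inv (B \<union> C) \<Sigma> *v ?v)"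
    unfolding sub_inv_proj_cov[OF pd disjoint] proj_prec_def
    by (simp add: matrix_vector_mult_add_rdistrib matrix_vector_mult_diff_rdistrib inner_add_right
        inner_diff_right)
  then have e: "exp (- (1/2) * (?v \<bullet> (sub_inv (A \<union> B \<union> C) Sq *v ?v))) * exp (- (1/2) * (?v \<bullet>
      (sub_inv C \<Sigma> *v ?v)))
     = exp (- (1/2) * (?v \<bullet> (sub_inv (A \<union> C) \<Sigma> *v ?v))) * exp (- (1/2) * (?v \<bullet> (sub_inv (B \<union> C) \<Sigma> *v
         ?v)))"
    unfolding mult_exp_exp distrib_left[symmetric] by simp
  show ?thesis
    unfolding gauss_dens_def times_divide_times_eq s e ..
qed

text \<open>Cross-multiplied equality of the conditional densities of the remaining
  variables.\<close>

lemma gauss_dens_proj_UNIV: "gp UNIV x * g (A \<union> B \<union> C) x = g UNIV x * gp (A \<union> B \<union> C) x"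
proof -
  let ?v = "(\<chi> i. x i) - \<mu>"
  have s: "sqrt ((2 * pi) ^ card (UNIV :: 'v set) * sub_det UNIV Sq) * sqrt ((2 * pi) ^ card (A \<union> B
      \<union> C) * sub_det (A \<union> B \<union> C) \<Sigma>)
      = sqrt ((2 * pi) ^ card (UNIV :: 'v set) * sub_det UNIV \<Sigma>) * sqrt ((2 * pi) ^ card (A \<union> B \<union> C)
          * sub_det (A \<union> B \<union> C) Sq)"
    unfolding real_sqrt_mult[symmetric]
    by (intro arg_cong[where f = sqrt] mult_interchange refl sub_det_proj_cov(2)[OF pd disjoint])
  have "?v \<bullet> (sub_inv UNIV Sq *v ?v) + ?v \<bullet> (sub_inv (A \<union> B \<union> C) \<Sigma> *v ?v)
      = ?v \<bullet> (sub_inv UNIV \<Sigma> *v ?v) + ?v \<bullet> (sub_inv (A \<union> B \<union> C) Sq *v ?v)"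
    unfolding sub_inv_proj_cov[OF pd disjoint] sub_inv_UNIV_proj_cov[OF pd disjoint]
    by (simp add: matrix_vector_mult_add_rdistrib matrix_vector_mult_diff_rdistrib inner_add_right
        inner_diff_right)
  then have e: "exp (- (1/2) * (?v \<bullet> (sub_inv UNIV Sq *v ?v))) * exp (- (1/2) * (?v \<bullet> (sub_inv (A \<union>
      B \<union> C) \<Sigma> *v ?v)))
     = exp (- (1/2) * (?v \<bullet> (sub_inv UNIV \<Sigma> *v ?v))) * exp (- (1/2) * (?v \<bullet> (sub_inv (A \<union> B \<union> C) Sq
         *v ?v)))"
    unfolding mult_exp_exp distrib_left[symmetric] by simp
  show ?thesis
    unfolding gauss_dens_def times_divide_times_eq s e ..
qed

lemma satisfies_ci_proj: "satisfies_ci Pp (A, B, C)"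
proof -
  note m = mdens_gaussian[OF pdp, of \<mu>]
  have "AE x in leb UNIV. cdens Pp (A \<union> B) C x = cdens Pp A C x * cdens Pp B C x"
    using m[of "A \<union> B \<union> C"] m[of C] m[of "A \<union> C"] m[of "B \<union> C"]
  proof eventually_elim
    case (elim x)
    have "gp (A \<union> B \<union> C) x * gp C x = gp (A \<union> C) x * gp (B \<union> C) x"
      using gauss_dens_proj_Y[of x] by (simp add: gauss_dens_proj_block)
    then show ?case
      using elim gauss_dens_pos[OF pdp, of \<mu> C x] by (simp add: cdens_def field_simps)
  qed
  then show ?thesis by simp
qed

section \<open>Comparison with an arbitrary competitor\<close>

lemma mdens_gaussian_pos: "AE x in leb UNIV. 0 < mdens P S x"
  using mdens_gaussian[OF pd, of \<mu> S] by eventually_elim (simp add: gauss_dens_pos[OF pd])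

text \<open>The log-ratio is a combination of log-densities of marginals of \<open>P\<close>, so the
  divergence of the candidate is finite.\<close>

lemma ln_gauss_ratio_integrable: "integrable P (\<lambda>x. ln (g UNIV x / gp UNIV x))"
proof -
  have pos: "0 < g S x" "0 < gp S x" for S x
    by (rule gauss_dens_pos[OF pd] gauss_dens_pos[OF pdp])+
  have "ln (g UNIV x / gp UNIV x) = ln (g (A \<union> B \<union> C) x) + ln (g C x) - ln (g (A \<union> C) x) - ln (g (B
      \<union> C) x)" for x
  proof -
    have "ln (gp UNIV x) + ln (g (A \<union> B \<union> C) x) = ln (g UNIV x) + ln (gp (A \<union> B \<union> C) x)"
      using gauss_dens_proj_UNIV[of x] pos by (metis ln_mult_pos)
    moreover have "ln (gp (A \<union> B \<union> C) x) + ln (g C x) = ln (g (A \<union> C) x) + ln (g (B \<union> C) x)"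
      using gauss_dens_proj_Y[of x] pos by (metis ln_mult_pos)
    ultimately show ?thesis
      using pos(1)[of UNIV x] pos(2)[of UNIV x] by (simp add: ln_div)
  qed
  then show ?thesis
    using gaussian_entropy(1) by simp
qed

text \<open>Assuming the competitor to be merely no worse gives minimality and uniqueness at
  once.\<close>

lemma KL_le_projection_eq:
  assumes Q: "Q \<in> distributions" "satisfies_ci Q (A, B, C)" and KL: "KL P Q \<le> KL P Pp"
  shows "Q = Pp"
proof -
  note Pd = gaussian_in_distributions[OF pd, of \<mu>] and Ppd = gaussian_in_distributions[OF pdp, of \<mu>]
  define q where "q = mdens Q"
  have pos: "0 < g S x" "0 < gp S x" for S x
    by (rule gauss_dens_pos[OF pd] gauss_dens_pos[OF pdp])+
  have mP: "AE x in leb UNIV. mdens P S x = g S x" and mPp: "AE x in leb UNIV. mdens Pp S x = gp S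
      x" for S
    by (rule mdens_gaussian[OF pd] mdens_gaussian[OF pdp])+
  have Ppos: "AE x in leb UNIV. 0 < mdens Pp UNIV x"
    using mPp[of UNIV] by eventually_elim (simp add: pos)
  note [measurable] = measurable_mdens[of _ UNIV, OF subset_UNIV]
  have [measurable]: "mdens R S \<in> borel_measurable P" "g S \<in> borel_measurable P" "gp S \<in>
      borel_measurable P" for R S
    using measurable_gauss_dens[of S UNIV] by (simp_all add: gaussian_density)
  have rI: "integrable P (\<lambda>x. ln (mdens P UNIV x / mdens Pp UNIV x))
      \<longleftrightarrow> integrable P (\<lambda>x. ln (g UNIV x / gp UNIV x))"
  proof (rule integrable_cong_AE)
    show "AE x in P. ln (mdens P UNIV x / mdens Pp UNIV x) = ln (g UNIV x / gp UNIV x)"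
      unfolding AE_gaussian[OF pd] using mP[of UNIV] mPp[of UNIV] by eventually_elim simp
  qed measurable
  have KLp: "KL P Pp = ereal (\<integral>x. ln (mdens P UNIV x / mdens Pp UNIV x) \<partial>P)"
    using KL_mdens[OF Pd mdens_gaussian_pos Ppd Ppos] rI ln_gauss_ratio_integrable by simp
  \<comment> \<open>Finite divergence gives absolute continuity of \<open>P\<close> with respect to
    \<open>Q\<close>. Since q is positive almost surely under \<open>Q\<close>, it is so under
    \<open>P\<close>, whose null sets are the Lebesgue ones.\<close>
  have qpos: "AE x in leb UNIV. 0 < q S x" for S
  proof -
    have "absolutely_continuous Q P"
      using KL KLp by (auto simp: KL_def split: if_splits)
    moreover have "AE x in Q. 0 < mdens Q UNIV x"
      by (subst distribution_density[OF Q(1)], subst AE_density) auto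
    ultimately have "AE x in P. 0 < mdens Q UNIV x"
      using absolutely_continuous_AE[of P Q] distributionsD(2)[OF Q(1)] distributionsD(2)[OF Pd] by
          simp
    then show ?thesis
      unfolding q_def AE_gaussian[OF pd] by (rule mdens_pos[OF Q(1)])
  qed
  note KLq = KL_mdens[OF Pd mdens_gaussian_pos Q(1) qpos[of UNIV, unfolded q_def]]
  have intq: "integrable P (\<lambda>x. ln (mdens P UNIV x / q UNIV x))"
    using KLq KLp KL unfolding q_def by (auto split: if_splits)
  have le: "(\<integral>x. ln (mdens P UNIV x / q UNIV x) \<partial>P) \<le> (\<integral>x. ln (mdens P UNIV x / mdens Pp UNIV x)
      \<partial>P)"
    using KLq KLp KL intq unfolding q_def by simp
  define r where "r S T x = (q T x / q S x) / (mdens P T x / mdens P S x)" for S T x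
  have r: "(\<integral>\<^sup>+ x. r S T x \<partial>P) = 1" if "S \<subseteq> T" for S T
    unfolding r_def q_def
    by (rule nn_integral_cond_density_ratio[OF Pd mdens_gaussian_pos Q(1) qpos[unfolded q_def]
        that])
  have ci: "AE x in leb UNIV. q (A \<union> B \<union> C) x * q C x = q (A \<union> C) x * q (B \<union> C) x"
  proof -
    have "AE x in leb UNIV. cdens Q (A \<union> B) C x = cdens Q A C x * cdens Q B C x"
      using Q(2) by simp
    with qpos[of C] show ?thesis
      by eventually_elim (simp add: cdens_def q_def field_simps)
  qed
  \<comment> \<open>The factors for (A,C), for B given C, and for the rest given
    \<open>A \<union> B \<union> C\<close>; conditioning on \<open>{}\<close> lets one lemma cover
    the first as well.\<close>
  let ?r1 = "r {} (A \<union> C)" and ?r2 = "r C (B \<union> C)" and ?r3 = "r (A \<union> B \<union> C) UNIV"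
  have prod: "AE x in leb UNIV. ?r1 x * ?r2 x * ?r3 x = q UNIV x / gp UNIV x
      \<and> 0 < ?r1 x \<and> 0 < ?r2 x \<and> 0 < ?r3 x \<and> mdens P UNIV x = g UNIV x \<and> mdens Pp UNIV x = gp UNIV x
      \<and> 0 < q UNIV x"
    using ci qpos[of "{}"] qpos[of "A \<union> C"] qpos[of "B \<union> C"] qpos[of C] qpos[of "A \<union> B \<union> C"] qpos[of
        UNIV]
      mP[of "A \<union> C"] mP[of "B \<union> C"] mP[of C] mP[of "A \<union> B \<union> C"] mP[of UNIV] mPp[of UNIV]
  proof eventually_elim
    case (elim x)
    have e: "q {} x = 1" "mdens P {} x = 1"
      by (simp_all add: q_def mdens_empty[OF Q(1)] mdens_empty[OF Pd])
    have "gp UNIV x * g (A \<union> B \<union> C) x * g C x = g UNIV x * (g (A \<union> C) x * g (B \<union> C) x)"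
      using gauss_dens_proj_UNIV[of x] gauss_dens_proj_Y[of x] by (simp add: mult.assoc)
    then have gp: "gp UNIV x = g (A \<union> C) x * g (B \<union> C) x / g C x * g UNIV x / g (A \<union> B \<union> C) x"
      using pos[of "A \<union> B \<union> C" x] pos[of C x] by (simp add: field_simps)
    have qY: "q (A \<union> B \<union> C) x = q (A \<union> C) x * q (B \<union> C) x / q C x"
      using elim by (simp add: field_simps)
    have "(a / 1) / (a' / 1) * ((b / c) / (b' / c')) * ((u / (a * b / c)) / (u' / y')) = u / (a' *
        b' / c' * u' / y')"
      if "0 < a" "0 < b" "0 < c" for a b c u a' b' c' u' y' :: real
      using that by (simp add: field_simps)
    from this[of "q (A \<union> C) x" "q (B \<union> C) x" "q C x" "g (A \<union> C) x" "g (B \<union> C) x" "g C x" "q UNIV x"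
        "g UNIV x" "g (A \<union> B \<union> C) x"]
    have "?r1 x * ?r2 x * ?r3 x = q UNIV x / gp UNIV x"
      using elim by (simp only: r_def e gp qY)
    then show ?case
      using elim pos by (simp add: r_def e)
  qed
  \<comment> \<open>The expectation of the right side is the divergence of the candidate minus that
    of the competitor, hence nonnegative by assumption.\<close>
  have lnr: "AE x in leb UNIV. ln (?r1 x * ?r2 x * ?r3 x)
      = ln (mdens P UNIV x / mdens Pp UNIV x) - ln (mdens P UNIV x / q UNIV x)"
    using prod
  proof eventually_elim
    case (elim x)
    then show ?case
      using pos(1)[of UNIV x] pos(2)[of UNIV x] by (simp add: ln_div)
  qed
  have rm [measurable]: "r S T \<in> borel_measurable P" for S T
    unfolding r_def q_def by measurable
  have int: "integrable P (\<lambda>x. ln (mdens P UNIV x / mdens Pp UNIV x) - ln (mdens P UNIV x / q UNIV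
      x))"
    using rI ln_gauss_ratio_integrable intq by simp
  have mq[measurable]: "q S \<in> borel_measurable P" for S
    unfolding q_def by measurable
  have "integrable P (\<lambda>x. ln (?r1 x * ?r2 x * ?r3 x))"
    using int by (rule integrable_cong_AE_imp) (measurable, use lnr in \<open>simp add: AE_gaussian[OF pd]
        eq_commute\<close>)
  moreover have "(\<integral>x. ln (?r1 x * ?r2 x * ?r3 x) \<partial>P)
      = (\<integral>x. ln (mdens P UNIV x / mdens Pp UNIV x) - ln (mdens P UNIV x / q UNIV x) \<partial>P)"
    by (rule integral_cong_AE, measurable, use lnr in \<open>simp add: AE_gaussian[OF pd]\<close>)
  then have "0 \<le> (\<integral>x. ln (?r1 x * ?r2 x * ?r3 x) \<partial>P)"
    using le intq rI ln_gauss_ratio_integrable by simp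
  ultimately have "AE x in P. ?r1 x = 1 \<and> ?r2 x = 1 \<and> ?r3 x = 1"
    using prod by (intro ln_product_expectation_nonneg r prob_space_gaussian[OF pd] rm)
      (auto simp: AE_gaussian[OF pd] elim: AE_mp)
  then have "AE x in leb UNIV. ?r1 x = 1 \<and> ?r2 x = 1 \<and> ?r3 x = 1"
    by (simp only: AE_gaussian[OF pd])
  with prod have "AE x in leb UNIV. mdens Q UNIV x = mdens Pp UNIV x"
  proof eventually_elim
    case (elim x)
    then show ?case using pos(2)[of UNIV x] by (simp add: q_def)
  qed
  then have "density (leb UNIV) (mdens Q UNIV) = density (leb UNIV) (mdens Pp UNIV)"
    by (intro density_cong) auto
  then show "Q = Pp"
    using distribution_density[OF Q(1)] distribution_density[OF Ppd] by simp
qed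

text \<open>\<open>ARG_MIN\<close> chooses some minimizer; the candidate shows that one exists, and
  uniqueness identifies the choice.\<close>

lemma moment_projection_gaussian: "moment_projection (A, B, C) P = Pp"
proof -
  let ?F = "\<lambda>Q. Q \<in> distributions \<and> satisfies_ci Q (A, B, C)"
  have F: "?F Pp"
    using gaussian_in_distributions[OF pdp] satisfies_ci_proj by simp
  have "is_arg_min (KL P) ?F Pp"
    unfolding is_arg_min_def using F KL_le_projection_eq less_imp_le by blast
  then have "is_arg_min (KL P) ?F (moment_projection (A, B, C) P)"
    unfolding moment_projection_def arg_min_def by (rule someI)
  then show ?thesis
    using F KL_le_projection_eq unfolding is_arg_min_linorder by blast
qed

end

end

text \<open>The blocks on \<open>A'\<close> and on \<open>B'\<close> stay because the marginals of
  (A',C') and (B',C') are kept. The blocks between \<open>X'\<close> and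
  \<open>A' \<union> B'\<close> may move: the regression of \<open>X'\<close> on \<open>Y'\<close>
  is kept while the covariance of \<open>Y'\<close> changes. Varying the mean \<nu> expresses that
  CIMD depends on \<Sigma> alone.\<close>

theorem mainTheorem1:
  fixes \<mu> :: "real^'v::finite" and \<Sigma> \<Sigma>p \<Omega> \<Phi> \<Phi>p :: "real^'v^'v"
    and P Pp :: "('v \<Rightarrow> real) measure"
    and A B C A' B' C' X' Y' Z :: "'v set"
  assumes "positive_definite \<Sigma>" and "P = gaussian \<mu> \<Sigma>"
    and "A \<inter> B = {}" and "A \<inter> C = {}" and "B \<inter> C = {}"
    and "A' \<inter> B' = {}" and "A' \<inter> C' = {}" and "B' \<inter> C' = {}"
    and "Pp = moment_projection (A', B', C') P"
    and "\<Sigma>p = covariance_matrix Pp"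
    and "Y' = A' \<union> B' \<union> C'" and "X' = UNIV - Y'"
    and "\<Omega> = sub_inv Y' \<Sigma>p - sub_inv Y' \<Sigma>"
    and "Z = A \<union> B" and "\<Phi> = cond_cov Z C \<Sigma>" and "\<Phi>p = cond_cov Z C \<Sigma>p"
  shows
    "marginal Pp C' = marginal P C' \<and>
     (AE x in leb UNIV. cdens Pp A' C' x = cdens P A' C' x) \<and>
     (AE x in leb UNIV. cdens Pp B' C' x = cdens P B' C' x) \<and>
     (AE x in leb UNIV. cdens Pp X' Y' x = cdens P X' Y' x) \<and>
     (\<forall>i j. \<Sigma>p $ i $ j \<noteq> \<Sigma> $ i $ j \<longrightarrow>
        (i, j) \<in> A' \<times> B' \<union> B' \<times> A' \<union> X' \<times> (A' \<union> B') \<union> (A' \<union> B') \<times> X' \<union> X' \<times> X') \<and>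
     sub A' B' \<Sigma>p = sub A' C' \<Sigma> ** sub_inv C' \<Sigma> ** sub C' B' \<Sigma> \<and>
     sub B' A' \<Sigma>p = sub B' C' \<Sigma> ** sub_inv C' \<Sigma> ** sub C' A' \<Sigma> \<and>
     sub X' Y' \<Sigma>p = sub X' Y' \<Sigma> ** sub_inv Y' \<Sigma> ** sub Y' Y' \<Sigma>p \<and>
     sub Y' X' \<Sigma>p = sub Y' Y' \<Sigma>p ** sub_inv Y' \<Sigma> ** sub Y' X' \<Sigma> \<and>
     sub X' X' \<Sigma>p = sub X' X' \<Sigma> - sub X' Y' \<Sigma>p ** \<Omega> ** sub Y' X' \<Sigma> \<and>
     CIMD (A, B, C) (A', B', C') P =
       1/2 * ln (sub_det A \<Phi> * sub_det B \<Phi> / sub_det Z \<Phi>)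
       - 1/2 * ln (sub_det A \<Phi>p * sub_det B \<Phi>p / sub_det Z \<Phi>p) \<and>
     (\<forall>\<nu>. CIMD (A, B, C) (A', B', C') (gaussian \<nu> \<Sigma>) = CIMD (A, B, C) (A', B', C') P)"
proof -
  note pd = assms(1) and P = assms(2) and d = assms(3-5) and d' = assms(6-8)
  let ?S = "proj_cov (A', B', C') \<Sigma>"
  have pdp: "positive_definite ?S"
    by (rule positive_definite_proj_cov[OF pd d'])
  have Pp: "moment_projection (A', B', C') (gaussian \<nu> \<Sigma>) = gaussian \<nu> ?S" for \<nu>
    by (rule moment_projection_gaussian[OF pd d'])
  have Pp_eq: "Pp = gaussian \<mu> ?S"
    using Pp assms(9) P by simp
  have S: "\<Sigma>p = ?S"
    using assms(10) covariance_matrix_gaussian[OF pdp] Pp_eq by simp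
  have CIMD: "CIMD (A, B, C) (A', B', C') (gaussian \<nu> \<Sigma>)
      = 1/2 * ln (sub_det A \<Phi> * sub_det B \<Phi> / sub_det Z \<Phi>)
        - 1/2 * ln (sub_det A \<Phi>p * sub_det B \<Phi>p / sub_det Z \<Phi>p)" for \<nu>
    unfolding CIMD_def Pp cond_mutual_info_gaussian[OF pd d] cond_mutual_info_gaussian[OF pdp d]
    using assms(14-16) S by simp
  have block: "gauss_dens \<mu> ?S T x = gauss_dens \<mu> \<Sigma> T x" if "T \<subseteq> A' \<union> C' \<or> T \<subseteq> B' \<union> C'" for T x
    by (rule gauss_dens_proj_block[OF pd d' that])
  have marg: "marginal Pp C' = marginal P C'"
    unfolding Pp_eq P marginal_gaussian[OF pd] marginal_gaussian[OF pdp] by (simp add: block)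
  have cdens: "AE x in leb UNIV. cdens Pp T U x = cdens P T U x"
    if "\<And>x. gauss_dens \<mu> ?S (T \<union> U) x / gauss_dens \<mu> ?S U x
      = gauss_dens \<mu> \<Sigma> (T \<union> U) x / gauss_dens \<mu> \<Sigma> U x" for T U
    using mdens_gaussian[OF pd, of \<mu> "T \<union> U"] mdens_gaussian[OF pd, of \<mu> U]
      mdens_gaussian[OF pdp, of \<mu> "T \<union> U"] mdens_gaussian[OF pdp, of \<mu> U]
    by eventually_elim (simp add: cdens_def Pp_eq P that)
  have A: "AE x in leb UNIV. cdens Pp A' C' x = cdens P A' C' x"
    and B: "AE x in leb UNIV. cdens Pp B' C' x = cdens P B' C' x"
    by (rule cdens; simp add: block)+
  have X: "AE x in leb UNIV. cdens Pp X' Y' x = cdens P X' Y' x"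
  proof (rule cdens)
    have "X' \<union> Y' = UNIV"
      by (simp add: assms(12))
    then show "gauss_dens \<mu> ?S (X' \<union> Y') x / gauss_dens \<mu> ?S Y' x
      = gauss_dens \<mu> \<Sigma> (X' \<union> Y') x / gauss_dens \<mu> \<Sigma> Y' x" for x
      using gauss_dens_proj_UNIV[OF pd d', of \<mu> x, folded assms(11)]
        gauss_dens_pos[OF pd, of \<mu> Y' x] gauss_dens_pos[OF pdp, of \<mu> Y' x]
      by (simp add: field_simps)
  qed
  have support: "\<forall>i j. \<Sigma>p $ i $ j \<noteq> \<Sigma> $ i $ j \<longrightarrow>
      (i, j) \<in> A' \<times> B' \<union> B' \<times> A' \<union> X' \<times> (A' \<union> B') \<union> (A' \<union> B') \<times> X' \<union> X' \<times> X'"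
    using proj_cov_support[OF pd d'] unfolding S assms(11,12) by blast
  note matrices = sub_proj_cov_AB[OF pd d', folded S] proj_cov_XY[OF pd d', of X', folded S assms(11)]
    proj_cov_XX[OF pd d', of X', folded S assms(11), folded assms(13)]
  show ?thesis
    by (intro conjI allI marg A B X support matrices) (simp_all only: CIMD P)
qed

end
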